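(* Let $\nu$ be a finite positive Borel measure on $[0,1]$, let $c_\nu\in[1,2]$ be its critical index and $c_\nu'$ the dual exponent of $c_\nu$. Then: (a) If $1\le c_\nu<2$, the operator $T_\nu:L^{c_\nu'}(\mathbb D)\to\mathcal B$ is bounded if and only if $\nu$ satisfies the $2/c_\nu'$-Carleson condition. (b) If $c_\nu=2$, the operator $T_\nu:L^2(\mathbb D)\to\mathcal B$ is bounded if and only if $\nu$ is integrable with respect to the hyperbolic arc length on $[0,1)$.
   Context: $\mathbb D$ is the open unit disk in $\mathbb C$, $dA$ is the Lebesgue area measure normalized so that $A(\mathbb D)=1$, and $L^p(\mathbb D)=L^p(\mathbb D,dA)$. For a finite positive Borel measure $\nu$ on $[0,1]$, $$T_\nu f(z)=\int_{\mathbb D}\frac{1}{1-z\overline\lambda}\left(\int_0^1\frac{d\nu(r)}{1-rz\overline\lambda}\right)f(\lambda)\,dA(\lambda),\quad z\in\mathbb D.$$ The critical index is $$c_\nu=\sup\left\{1\le c<2:\ \int_0^1\frac{1}{(1-r^2)^{2/c'}}\,d\nu(r)<\infty\right\},$$ where $c'$ denotes the dual exponent, $1/c+1/c'=1$ (with $1'=\infty$, $1/\infty=0$). The Bloch space $\mathcal B$ is the space of holomorphic $f$ on $\mathbb D$ with $\|f\|_{\mathcal B}=|f(0)|+\sup_{z\in\mathbb D}(1-|z|^2)|f'(z)|<\infty$. For $\alpha\ge0$, $\nu$ satisfies the $\alpha$-Carleson condition if $\sup_{0<t\le1}\nu([1-t,1))/t^\alpha<\infty$ (for $\alpha=0$ this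 just says that $\nu$ is finite). $\nu$ is integrable with respect to the hyperbolic arc length on $[0,1)$ if $\int_{[0,1)}\frac{1}{1-r^2}\,d\nu(r)<\infty$. *)

theory Defs
  imports "HOL-Probability.Essential_Supremum" "HOL-Complex_Analysis.Complex_Analysis"
begin

definition disc_area :: "complex measure" where
  "disc_area = density (lebesgue_on (ball 0 1)) (\<lambda>_. ennreal (1 / pi))"

lemma space_disc_area [simp]: "space disc_area = ball 0 1"
  by (simp add: disc_area_def)

lemma emeasure_disc_area_ball: "emeasure disc_area (ball 0 1) = 1"
proof -
  have "emeasure lebesgue (ball (0::complex) 1) = ennreal pi"
    using emeasure_ball[of 1 "0::complex"] by (simp add: unit_ball_vol_2)
  then have "emeasure (lebesgue_on (ball 0 1)) (ball (0::complex) 1) = ennreal pi"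
    by (simp add: emeasure_restrict_space)
  then show ?thesis
    unfolding disc_area_def
    by (subst emeasure_density_const)
       (auto simp: ennreal_mult[symmetric] sets_restrict_space_iff)
qed

definition conj_exponent :: "real \<Rightarrow> ennreal" where
  "conj_exponent c = (if c = 1 then \<infinity> else ennreal (c / (c - 1)))"

lemma conj_exponent:
  assumes "1 \<le> c"
  shows "1 / ennreal c + 1 / conj_exponent c = 1"
proof (cases "c = 1")
  case False
  with assms have "c > 1" by simp
  then have "1 / ennreal c = ennreal (1 / c)" "1 / conj_exponent c = ennreal ((c - 1) / c)"
    by (simp_all add: conj_exponent_def divide_ennreal flip: ennreal_1)
  with \<open>c > 1\<close> show ?thesis
    by (simp add: diff_divide_distrib flip: ennreal_plus)
qed (simp add: conj_exponent_def)

text \<open>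
  Elements of \<open>L\<^sup>p\<close> are represented by functions rather than by almost-everywhere classes; as
  \<open>T_op\<close> below is an integral against \<open>f\<close>, it depends on the class only. The norm is used for
  \<open>1 \<le> p \<le> \<infinity>\<close>.
\<close>

definition Lp_norm :: "ennreal \<Rightarrow> 'a measure \<Rightarrow> ('a \<Rightarrow> complex) \<Rightarrow> ennreal" where
  "Lp_norm p M f =
    (if p = \<infinity> then esssup M (\<lambda>x. ennreal (norm (f x)))
     else let I = \<integral>\<^sup>+x. ennreal (norm (f x) powr enn2real p) \<partial>M
          in if I = \<infinity> then \<infinity> else ennreal (enn2real I powr (1 / enn2real p)))"

definition Lp_space :: "ennreal \<Rightarrow> 'a measure \<Rightarrow> ('a \<Rightarrow> complex) set" where
  "Lp_space p M = {f \<in> borel_measurable M. Lp_norm p M f < \<infinity>}"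

definition bloch_norm :: "(complex \<Rightarrow> complex) \<Rightarrow> ennreal" where
  "bloch_norm f =
    ennreal (norm (f 0)) + (SUP z\<in>ball 0 1. ennreal ((1 - (norm z)\<^sup>2) * norm (deriv f z)))"

definition bloch_space :: "(complex \<Rightarrow> complex) set" where
  "bloch_space = {f. f holomorphic_on ball 0 1 \<and> bloch_norm f < \<infinity>}"

text \<open>
  For \<open>z\<close> in the disc and \<open>f\<close> in \<open>L\<^sup>p\<close>, \<open>p \<ge> 1\<close>, both integrals converge absolutely: the inner
  integrand is at most \<open>1 / (1 - \<bar>z\<bar>)\<close> in modulus.
\<close>

definition T_op :: "real measure \<Rightarrow> (complex \<Rightarrow> complex) \<Rightarrow> complex \<Rightarrow> complex" where
  "T_op \<nu> f z =
    (LINT w|disc_area. 1 / (1 - z * cnj w) * (LINT r|\<nu>. 1 / (1 - of_real r * z * cnj w)) * f w)"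

definition T_bounded_Lp_Bloch :: "real measure \<Rightarrow> ennreal \<Rightarrow> bool" where
  "T_bounded_Lp_Bloch \<nu> p \<longleftrightarrow>
    (\<forall>f \<in> Lp_space p disc_area. T_op \<nu> f \<in> bloch_space) \<and>
    (\<exists>C::real. \<forall>f \<in> Lp_space p disc_area.
        bloch_norm (T_op \<nu> f) \<le> ennreal C * Lp_norm p disc_area f)"

text \<open>
  The value of \<open>1 / (1 - r\<^sup>2)\<^sup>s\<close> for \<open>s \<ge> 0\<close> in \<open>[0,\<infinity>]\<close>. At \<open>r = 1\<close> it is \<open>\<infinity>\<close> for \<open>s > 0\<close> and
  \<open>1\<close> for \<open>s = 0\<close>; the case \<open>s = 0\<close> is separate because \<open>0 powr 0 = 0\<close>.
\<close>

definition inv_power_weight :: "real \<Rightarrow> real \<Rightarrow> ennreal" where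
  "inv_power_weight s r = (if s = 0 then 1 else 1 / ennreal ((1 - r\<^sup>2) powr s))"

definition critical_index :: "real measure \<Rightarrow> real" where
  "critical_index \<nu> =
    Sup {c. 1 \<le> c \<and> c < 2 \<and>
            (\<integral>\<^sup>+r. inv_power_weight (enn2real (2 / conj_exponent c)) r \<partial>\<nu>) < \<infinity>}"

lemma critical_index_bounds:
  assumes "finite_measure \<nu>"
  shows "critical_index \<nu> \<in> {1..2}"
proof -
  let ?S = "{c. 1 \<le> c \<and> c < 2 \<and>
            (\<integral>\<^sup>+r. inv_power_weight (enn2real (2 / conj_exponent c)) r \<partial>\<nu>) < \<infinity>}"
  have 1: "1 \<in> ?S"
    using finite_measure.finite_emeasure_space[OF assms]
    by (simp add: conj_exponent_def inv_power_weight_def top.not_eq_extremum)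
  have "bdd_above ?S"
    by (rule bdd_aboveI[of _ 2]) auto
  then have "1 \<le> Sup ?S"
    using 1 by (rule cSup_upper[rotated])
  moreover have "Sup ?S \<le> 2"
    using 1 by (intro cSup_least) (blast, simp)
  ultimately show ?thesis
    by (simp add: critical_index_def)
qed

definition carleson_condition :: "real \<Rightarrow> real measure \<Rightarrow> bool" where
  "carleson_condition \<alpha> \<nu> \<longleftrightarrow>
    (SUP t\<in>{0<..1}. emeasure \<nu> {1 - t..<1} / ennreal (t powr \<alpha>)) < \<infinity>"

definition hyperbolically_integrable :: "real measure \<Rightarrow> bool" where
  "hyperbolically_integrable \<nu> \<longleftrightarrow> (\<integral>\<^sup>+r\<in>{0..<1}. ennreal (1 / (1 - r\<^sup>2)) \<partial>\<nu>) < \<infinity>"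

end

theory Submission
  imports Defs
begin

text \<open>
  Write \<open>h u = \<integral> d\<nu>(r) / ((1 - u) (1 - r u))\<close>. Then \<open>T f z\<close> is the integral of \<open>h (z \<lambda>\<^sup>*) f(\<lambda>)\<close> over
  the disc, where \<open>\<lambda>\<^sup>*\<close> is the conjugate of \<open>\<lambda>\<close>, and differentiation under the integral sign
  turns \<open>h (z \<lambda>\<^sup>*)\<close> into \<open>\<lambda>\<^sup>* h' (z \<lambda>\<^sup>*)\<close>. Everything is governed by the function
  \<open>\<kappa>(\<rho>) = \<integral> d\<nu>(r) / (1 - r \<rho>)\<close>, \<open>0 \<le> \<rho> < 1\<close>. Put \<open>\<alpha> = 2 / c' = 2 - 2 / c\<close>. For \<open>1 < c \<le> 2\<close>,
  boundedness of \<open>T\<close> from \<open>L\<^sup>p\<close>, \<open>p = c'\<close>, to the Bloch space is equivalent to the bound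
  \<open>\<kappa>(\<rho>) \<le> C (1 - \<rho>) powr (\<alpha> - 1)\<close>.

  For sufficiency (\<open>T_bounded_of_kappa_bounded\<close>), the inequality \<open>\<bar>1 - u\<bar> \<le> 2 \<bar>1 - r u\<bar>\<close> gives the
  pointwise bound \<open>\<bar>h' (z \<lambda>\<^sup>*)\<bar> \<le> 3 \<kappa>(\<bar>z\<bar>) / \<bar>1 - z \<lambda>\<^sup>*\<bar>\<^sup>2\<close>. Since the integral of
  \<open>\<bar>1 - z \<lambda>\<^sup>*\<bar> powr (-2c)\<close> over the disc is \<open>O((1 - \<bar>z\<bar>) powr (2 - 2c))\<close>, Hoelder's inequality
  finishes the proof. For \<open>c = 1\<close> this would lose a logarithm; there the bound
  \<open>\<bar>h' u\<bar> \<le> 6 \<nu>([0,1]) / \<bar>1 - u\<bar>\<^sup>3\<close> is integrated instead, and \<open>T\<close> is bounded for every finite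
  \<open>\<nu>\<close> (\<open>T_bounded_Linfty_Bloch\<close>), which agrees with the \<open>0\<close>-Carleson condition being void.

  For necessity (\<open>kappa_bounded_of_T_bounded\<close>), \<open>T\<close> is tested on the indicator of the disc of radius
  \<open>(1 - \<rho>) / 20\<close> about \<open>\<rho>\<close>. All factors of the kernel are there so close to their positive values
  at the centre that its real part is at least a multiple of \<open>\<kappa>(\<rho>) / (1 - \<rho>)\<^sup>2\<close>.

  It remains to translate the bound on \<open>\<kappa>\<close>. For \<open>0 < \<alpha> < 1\<close> it is the \<open>\<alpha>\<close>-Carleson condition, by
  a dyadic decomposition (\<open>nn_integral_negative_power_le\<close>, which also serves for the integral over
  the disc); for \<open>\<alpha> = 1\<close> it says that \<open>\<kappa>\<close> is bounded, which by Fatou's lemma is hyperbolic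
  integrability. Both conditions ignore a point mass at \<open>1\<close>, whereas \<open>\<kappa>\<close> sees it; but a critical
  index above \<open>1\<close> excludes such a mass (\<open>emeasure_one_eq_0\<close>). Apart from this the critical index
  only fixes the exponent.
\<close>

section \<open>Differentiation under the integral sign and a dyadic estimate\<close>

lemma has_field_derivative_lebesgue_integral:
  fixes G G' :: "'b::{real_normed_field, banach, second_countable_topology} \<Rightarrow> 'a \<Rightarrow> 'b"
  assumes S: "open S" "convex S" "z \<in> S"
    and int: "\<And>y. y \<in> S \<Longrightarrow> integrable M (G y)"
    and meas: "G' z \<in> borel_measurable M"
    and deriv: "\<And>x y. x \<in> space M \<Longrightarrow> y \<in> S \<Longrightarrow> ((\<lambda>y. G y x) has_field_derivative G' y x) (at y)"
    and bound: "\<And>x y. x \<in> space M \<Longrightarrow> y \<in> S \<Longrightarrow> norm (G' y x) \<le> B x"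
    and B: "integrable M B"
  shows "((\<lambda>y. LINT x|M. G y x) has_field_derivative (LINT x|M. G' z x)) (at z)"
proof -
  let ?F = "\<lambda>y. LINT x|M. G y x"
  have "((\<lambda>y. (?F y - ?F z) / (y - z)) \<longlongrightarrow> (LINT x|M. G' z x)) (at z within S)"
    unfolding tendsto_at_iff_sequentially
  proof (intro allI impI)
    fix X assume X: "\<forall>i. X i \<in> S - {z}" "X \<longlonglongrightarrow> z"
    let ?q = "\<lambda>i x. (G (X i) x - G z x) / (X i - z)"
    have "(\<lambda>i. LINT x|M. ?q i x) \<longlonglongrightarrow> (LINT x|M. G' z x)"
    \<comment> \<open>The mean value inequality on \<open>S\<close> bounds the difference quotients by \<open>B\<close>.\<close>
    proof (rule integral_dominated_convergence[OF meas _ B])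
      show "?q i \<in> borel_measurable M" for i
        using int[of "X i"] int[of z] X(1) S(3)
        by (intro borel_measurable_divide borel_measurable_diff) (auto dest: borel_measurable_integrable)
      show "AE x in M. (\<lambda>i. ?q i x) \<longlonglongrightarrow> G' z x"
      proof (rule AE_I2)
        fix x assume "x \<in> space M"
        from deriv[OF this S(3)]
        have "((\<lambda>y. (G y x - G z x) / (y - z)) \<longlongrightarrow> G' z x) (at z)"
          by (simp add: has_field_derivative_iff)
        with X show "(\<lambda>i. ?q i x) \<longlonglongrightarrow> G' z x"
          unfolding tendsto_at_iff_sequentially by (auto simp: o_def)
      qed
      show "AE x in M. norm (?q i x) \<le> B x" for i
      proof (rule AE_I2)
        fix x assume x: "x \<in> space M"
        have "norm (G (X i) x - G z x) \<le> B x * norm (X i - z)"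
          using X(1) S(3) bound[OF x] deriv[OF x]
          by (intro field_differentiable_bound[OF S(2), where f' = "\<lambda>y. G' y x"])
             (auto intro: has_field_derivative_at_within)
        then show "norm (?q i x) \<le> B x"
          using X(1) by (simp add: norm_divide divide_le_eq)
      qed
    qed
    also have "(\<lambda>i. LINT x|M. ?q i x) = (\<lambda>y. (?F y - ?F z) / (y - z)) \<circ> X"
      using int[of "X _"] int[of z] X(1) S(3) by (auto simp: fun_eq_iff)
    finally show "((\<lambda>y. (?F y - ?F z) / (y - z)) \<circ> X) \<longlonglongrightarrow> (LINT x|M. G' z x)" .
  qed
  then show ?thesis
    unfolding has_field_derivative_iff at_within_open[OF S(3,1)] .
qed

text \<open>
  The hypothesis bounds the measure of the sublevel sets of \<open>g\<close>; the integral is split over the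
  sets where \<open>2 ^ k * d \<le> g < 2 ^ (k + 1) * d\<close> and compared with a geometric series.
\<close>
lemma nn_integral_negative_power_le:
  fixes g :: "'a \<Rightarrow> real"
  assumes [measurable]: "g \<in> borel_measurable M"
    and d: "0 < d" "\<And>x. x \<in> space M \<Longrightarrow> d \<le> g x"
    and dist: "\<And>s. 0 < s \<Longrightarrow> emeasure M {x \<in> space M. g x < s} \<le> ennreal (C * s powr a)"
    and "0 \<le> C" "a < q" "0 \<le> q"
  shows "(\<integral>\<^sup>+x. ennreal (g x powr -q) \<partial>M)
           \<le> ennreal (C * 2 powr a / (1 - 2 powr (a - q)) * d powr (a - q))"
proof -
  \<comment> \<open>On the \<open>k\<close>-th dyadic level \<open>g powr -q\<close> is at most \<open>(2 ^ k * d) powr -q\<close>.\<close>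
  let ?T = "\<lambda>k x. ennreal ((2 ^ k * d) powr -q) * indicator {x \<in> space M. g x < 2 ^ Suc k * d} x"
  have ptw: "ennreal (g x powr -q) \<le> (\<Sum>k. ?T k x)" if x: "x \<in> space M" for x
  proof -
    obtain n where "g x / d < 2 ^ n"
      using real_arch_pow[of 2 "g x / d"] by auto
    then have ex: "\<exists>n. g x < 2 ^ n * d"
      using d by (auto simp: field_simps)
    define n where "n = (LEAST n. g x < 2 ^ n * d)"
    have n: "g x < 2 ^ n * d"
      unfolding n_def using ex by (rule LeastI_ex)
    have "n \<noteq> 0" using n d(2)[OF x] by (cases n) auto
    then obtain k where k: "n = Suc k" by (cases n) auto
    have "\<not> g x < 2 ^ k * d"
      using not_less_Least[of k "\<lambda>n. g x < 2 ^ n * d"] k n_def by auto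
    then have "g x powr -q \<le> (2 ^ k * d) powr -q"
      using d(1) \<open>0 \<le> q\<close> by (intro powr_mono2') auto
    then have "ennreal (g x powr -q) \<le> ?T k x"
      using n k x by (simp add: indicator_def ennreal_leI)
    also have "\<dots> \<le> (\<Sum>k. ?T k x)"
      using sum_le_suminf[of "\<lambda>k. ?T k x" "{k}"] by (simp del: sum_mult_indicator)
    finally show ?thesis .
  qed
  have term_le: "(\<integral>\<^sup>+x. ?T k x \<partial>M) \<le> ennreal (C * 2 powr a * d powr (a - q) * (2 powr (a - q)) ^ k)"
    for k
  proof -
    have "(\<integral>\<^sup>+x. ?T k x \<partial>M) = ennreal ((2 ^ k * d) powr -q) * emeasure M {x \<in> space M. g x < 2 ^ Suc k * d}"
      by (subst nn_integral_cmult_indicator) auto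
    also have "\<dots> \<le> ennreal ((2 ^ k * d) powr -q) * ennreal (C * (2 ^ Suc k * d) powr a)"
      using d(1) by (intro mult_left_mono dist) auto
    also have "\<dots> = ennreal ((2 ^ k * d) powr -q * (C * (2 ^ Suc k * d) powr a))"
      using \<open>0 \<le> C\<close> by (intro ennreal_mult[symmetric]) auto
    also have "(2 ^ k * d) powr -q * (C * (2 ^ Suc k * d) powr a)
                 = C * 2 powr a * d powr (a - q) * (2 powr (a - q)) ^ k"
    proof -
      have 1: "(2 ^ Suc k * d) powr a = 2 powr a * (2 ^ k * d) powr a"
        by (simp only: power_Suc mult.assoc powr_mult)
      have 2: "(2 ^ k * d) powr -q * (2 ^ k * d) powr a = (2 ^ k * d) powr (a - q)"
        by (simp only: powr_add[symmetric] uminus_add_conv_diff)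
      have 3: "(2 ^ k * d) powr (a - q) = (2 powr (a - q)) ^ k * d powr (a - q)"
      proof -
        have "((2::real) ^ k) powr (a - q) = (2 powr (a - q)) ^ k"
          by (simp only: powr_realpow[symmetric] zero_less_numeral powr_gt_zero
              powr_powr mult.commute)
        then show ?thesis
          by (simp only: powr_mult)
      qed
      have "(2 ^ k * d) powr -q * (C * (2 ^ Suc k * d) powr a)
          = C * 2 powr a * ((2 ^ k * d) powr -q * (2 ^ k * d) powr a)"
        unfolding 1 by (simp only: ac_simps)
      then show ?thesis
        unfolding 2 3 by (simp only: ac_simps)
    qed
    finally show ?thesis .
  qed
  have r: "0 < 2 powr (a - q)" "2 powr (a - q) < 1"
    using \<open>a < q\<close> by (auto simp: powr_less_one)
  have "(\<integral>\<^sup>+x. ennreal (g x powr -q) \<partial>M) \<le> (\<integral>\<^sup>+x. (\<Sum>k. ?T k x) \<partial>M)"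
    by (intro nn_integral_mono ptw)
  also have "\<dots> = (\<Sum>k. \<integral>\<^sup>+x. ?T k x \<partial>M)"
    by (rule nn_integral_suminf) auto
  also have "\<dots> \<le> (\<Sum>k. ennreal (C * 2 powr a * d powr (a - q) * (2 powr (a - q)) ^ k))"
    by (intro suminf_le term_le) auto
  also have "\<dots> = ennreal (\<Sum>k. C * 2 powr a * d powr (a - q) * (2 powr (a - q)) ^ k)"
    using r \<open>0 \<le> C\<close> by (intro suminf_ennreal2) (auto intro!: summable_mult summable_geometric)
  also have "(\<Sum>k. C * 2 powr a * d powr (a - q) * (2 powr (a - q)) ^ k)
               = C * 2 powr a / (1 - 2 powr (a - q)) * d powr (a - q)"
    using r by (subst suminf_mult) (auto simp: suminf_geometric intro!: summable_geometric)
  finally show ?thesis .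
qed

section \<open>Hoelder's inequality\<close>

lemma Holder_nn_integral_le:
  fixes f g :: "'a \<Rightarrow> 'b::real_normed_div_algebra"
  assumes [measurable]: "f \<in> borel_measurable M" "g \<in> borel_measurable M"
    and cp: "1 < c" "1 < p" "1 / c + 1 / p = 1"
    and AB: "0 < A" "0 < B"
    and g: "(\<integral>\<^sup>+x. ennreal (norm (g x) powr c) \<partial>M) \<le> ennreal (A powr c)"
    and f: "(\<integral>\<^sup>+x. ennreal (norm (f x) powr p) \<partial>M) \<le> ennreal (B powr p)"
  shows "(\<integral>\<^sup>+x. ennreal (norm (g x * f x)) \<partial>M) \<le> ennreal (A * B)"
proof -
  define u where "u = A * B / (c * A powr c)"
  define v where "v = A * B / (p * B powr p)"
  have uv: "0 \<le> u" "0 \<le> v"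
    using cp AB by (auto simp: u_def v_def)
  \<comment> \<open>Young's inequality for \<open>norm (g x) / A\<close> and \<open>norm (f x) / B\<close>, multiplied by \<open>A * B\<close>.\<close>
  have "norm (g x * f x) \<le> u * norm (g x) powr c + v * norm (f x) powr p" for x
  proof -
    have "norm (g x) / A * (norm (f x) / B) \<le> (norm (g x) / A) powr c / c + (norm (f x) / B) powr p / p"
      using cp AB by (intro Youngs_inequality) auto
    then have "(A * B) * (norm (g x) / A * (norm (f x) / B))
        \<le> (A * B) * ((norm (g x) / A) powr c / c + (norm (f x) / B) powr p / p)"
      using AB by (intro mult_left_mono) auto
    then show ?thesis
      using AB by (simp add: norm_mult u_def v_def powr_divide distrib_left mult.commute)
  qed
  then have "(\<integral>\<^sup>+x. ennreal (norm (g x * f x)) \<partial>M)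
      \<le> (\<integral>\<^sup>+x. ennreal u * ennreal (norm (g x) powr c) + ennreal v * ennreal (norm (f x) powr p) \<partial>M)"
    using uv by (intro nn_integral_mono) (simp add: ennreal_leI flip: ennreal_mult ennreal_plus)
  also have "\<dots> = ennreal u * (\<integral>\<^sup>+x. ennreal (norm (g x) powr c) \<partial>M)
                + ennreal v * (\<integral>\<^sup>+x. ennreal (norm (f x) powr p) \<partial>M)"
    by (simp add: nn_integral_add nn_integral_cmult)
  also have "\<dots> \<le> ennreal u * ennreal (A powr c) + ennreal v * ennreal (B powr p)"
    by (intro add_mono mult_left_mono f g) auto
  also have "\<dots> = ennreal (u * A powr c + v * B powr p)"
    using uv by (simp flip: ennreal_mult ennreal_plus)
  also have "u * A powr c + v * B powr p = A * B * (1 / c + 1 / p)"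
    using AB cp by (simp add: u_def v_def field_simps)
  finally show ?thesis
    using cp by simp
qed

lemma conj_exponent_real:
  assumes "1 < c"
  shows "1 < c / (c - 1)" "1 / c + 1 / (c / (c - 1)) = 1"
    "conj_exponent c = ennreal (c / (c - 1))" "conj_exponent c \<noteq> \<infinity>"
    "enn2real (conj_exponent c) = c / (c - 1)"
  using assms by (auto simp: conj_exponent_def field_simps)

lemma Lp_norm_finite:
  assumes "1 < c" "f \<in> Lp_space (conj_exponent c) M"
  shows "Lp_norm (conj_exponent c) M f
           = ennreal (enn2real (\<integral>\<^sup>+x. ennreal (norm (f x) powr (c / (c - 1))) \<partial>M) powr ((c - 1) / c))"
    and "(\<integral>\<^sup>+x. ennreal (norm (f x) powr (c / (c - 1))) \<partial>M) < \<infinity>"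
  using assms(2) conj_exponent_real[OF assms(1)]
  by (auto simp: Lp_space_def Lp_norm_def Let_def less_top split: if_splits)

text \<open>
  Hoelder's inequality between \<open>c\<close> and its dual exponent, which is \<open>\<infinity>\<close> for \<open>c = 1\<close>.
\<close>
lemma Lp_pairing_nn_integral_le:
  assumes c: "1 \<le> c" and f: "f \<in> Lp_space (conj_exponent c) M"
    and g[measurable]: "g \<in> borel_measurable M" and A: "0 < A"
    and gA: "(\<integral>\<^sup>+x. ennreal (norm (g x) powr c) \<partial>M) \<le> ennreal (A powr c)"
  shows "(\<integral>\<^sup>+x. ennreal (norm (g x * f x)) \<partial>M) \<le> ennreal A * Lp_norm (conj_exponent c) M f"
proof (cases "c = 1")
  case True
  have [measurable]: "f \<in> borel_measurable M"
    using f by (simp add: Lp_space_def)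
  let ?N = "esssup M (\<lambda>x. ennreal (norm (f x)))"
  have N: "Lp_norm (conj_exponent c) M f = ?N"
    using True by (simp add: conj_exponent_def Lp_norm_def)
  have "(\<integral>\<^sup>+x. ennreal (norm (g x * f x)) \<partial>M) \<le> (\<integral>\<^sup>+x. ennreal (norm (g x)) * ?N \<partial>M)"
    using esssup_AE[of "\<lambda>x. ennreal (norm (f x))" M]
    by (intro nn_integral_mono_AE) (auto simp: norm_mult ennreal_mult intro!: mult_left_mono elim!: eventually_mono)
  also have "\<dots> = (\<integral>\<^sup>+x. ennreal (norm (g x)) \<partial>M) * ?N"
    by (rule nn_integral_multc) auto
  also have "\<dots> \<le> ennreal A * ?N"
    using gA A True by (intro mult_right_mono) auto
  finally show ?thesis by (simp add: N)
next
  case False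
  with c have c1: "1 < c" by simp
  define p where "p = c / (c - 1)"
  have fm: "f \<in> borel_measurable M"
    using f by (simp add: Lp_space_def)
  define I where "I = (\<integral>\<^sup>+x. ennreal (norm (f x) powr p) \<partial>M)"
  define N where "N = enn2real I powr (1 / p)"
  have LN: "Lp_norm (conj_exponent c) M f = ennreal N" and Ifin: "I < \<infinity>"
    using Lp_norm_finite[OF c1 f] c1 by (auto simp: N_def I_def p_def)
  have p1: "1 < p" "1 / c + 1 / p = 1"
    using conj_exponent_real[OF c1] by (simp_all add: p_def)
  have N0: "0 \<le> N" by (simp add: N_def)
  have IN: "I = ennreal (N powr p)"
    using Ifin p1 by (simp add: N_def powr_powr less_top)
  have "(\<integral>\<^sup>+x. ennreal (norm (g x * f x)) \<partial>M) \<le> ennreal (A * N)"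
  \<comment> \<open>The slack \<open>e\<close> keeps the norm bound positive, since \<open>N\<close> may be \<open>0\<close>.\<close>
  proof (rule ennreal_le_epsilon)
    fix e :: real assume e: "0 < e"
    have "I \<le> ennreal ((N + e / A) powr p)"
      unfolding IN using e A p1 N0 by (intro ennreal_leI powr_mono2) auto
    then have "(\<integral>\<^sup>+x. ennreal (norm (g x * f x)) \<partial>M) \<le> ennreal (A * (N + e / A))"
      using e A N0 unfolding I_def
      by (intro Holder_nn_integral_le[OF fm g c1 p1 A _ gA]) (auto intro: add_nonneg_pos)
    also have "A * (N + e / A) = A * N + e"
      using A by (simp add: field_simps)
    finally show "(\<integral>\<^sup>+x. ennreal (norm (g x * f x)) \<partial>M) \<le> ennreal (A * N) + ennreal e"
      using A N0 e by (simp add: ennreal_plus)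
  qed
  then show ?thesis
    using A N0 by (simp add: LN ennreal_mult)
qed

lemma
  assumes c: "1 \<le> c" and f: "f \<in> Lp_space (conj_exponent c) M"
    and g[measurable]: "g \<in> borel_measurable M" and A: "0 < A"
    and gA: "(\<integral>\<^sup>+x. ennreal (norm (g x) powr c) \<partial>M) \<le> ennreal (A powr c)"
  shows Lp_pairing_integrable: "integrable M (\<lambda>x. g x * f x)"
    and Lp_pairing_le:
      "ennreal (norm (LINT x|M. g x * f x)) \<le> ennreal A * Lp_norm (conj_exponent c) M f"
proof -
  have [measurable]: "f \<in> borel_measurable M" and fin: "Lp_norm (conj_exponent c) M f < \<infinity>"
    using f by (auto simp: Lp_space_def)
  note le = Lp_pairing_nn_integral_le[OF assms]
  also have "ennreal A * Lp_norm (conj_exponent c) M f < \<infinity>"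
    using fin by (simp add: ennreal_mult_less_top)
  finally show int: "integrable M (\<lambda>x. g x * f x)"
    by (simp add: integrable_iff_bounded)
  show "ennreal (norm (LINT x|M. g x * f x)) \<le> ennreal A * Lp_norm (conj_exponent c) M f"
    using integral_norm_bound_ennreal[OF int] le by (rule order_trans)
qed

lemma enn2real_two_div_conj_exponent:
  assumes "1 < c"
  shows "enn2real (2 / conj_exponent c) = 2 - 2 / c"
proof -
  have "2 / conj_exponent c = ennreal (2 / (c / (c - 1)))"
    using assms by (simp add: conj_exponent_real(3) divide_ennreal flip: ennreal_numeral)
  also have "2 / (c / (c - 1)) = 2 - 2 / c"
    using assms by (simp add: field_simps)
  finally show ?thesis
    using assms by (simp add: divide_le_eq)
qed

section \<open>Area measure on the disc\<close>

interpretation disc_area: finite_measure disc_area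
  by standard (simp add: emeasure_disc_area_ball)

lemma borel_measurable_disc_area_continuous:
  fixes f :: "complex \<Rightarrow> 'b::{topological_space}"
  assumes "continuous_on (ball 0 1) f"
  shows "f \<in> borel_measurable disc_area"
  using continuous_imp_measurable_on_sets_lebesgue[OF assms] by (simp add: disc_area_def)

lemma sets_disc_area_ball: "S \<in> sets borel \<Longrightarrow> S \<inter> ball 0 1 \<in> sets disc_area"
  by (auto simp: disc_area_def sets_restrict_space)

lemma emeasure_disc_area:
  assumes "S \<in> sets borel" "S \<subseteq> ball 0 1"
  shows "emeasure disc_area S = ennreal (1 / pi) * emeasure lborel S"
proof -
  have S: "S \<in> sets (lebesgue_on (ball 0 1))"
    using assms by (auto simp: sets_restrict_space_iff)
  then have "emeasure disc_area S = ennreal (1 / pi) * emeasure (lebesgue_on (ball 0 1)) S"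
    unfolding disc_area_def by (rule emeasure_density_const)
  then show ?thesis
    using assms by (simp add: emeasure_restrict_space)
qed

lemma emeasure_disc_area_subball:
  assumes "0 \<le> r" "ball a r \<subseteq> ball 0 1"
  shows "emeasure disc_area (ball a r) = ennreal (r\<^sup>2)"
proof -
  have "emeasure lborel (ball a r) = ennreal (pi * r\<^sup>2)"
    using emeasure_ball[OF assms(1), of a] by (simp add: unit_ball_vol_2)
  then show ?thesis
    using assms by (simp add: emeasure_disc_area flip: ennreal_mult)
qed

lemma emeasure_disc_area_Int_ball_le:
  assumes "0 \<le> r"
  shows "emeasure disc_area (ball a r \<inter> ball 0 1) \<le> ennreal (r\<^sup>2)"
proof -
  have "emeasure disc_area (ball a r \<inter> ball 0 1) \<le> ennreal (1 / pi) * emeasure lborel (ball a r)"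
    by (subst emeasure_disc_area) (auto intro!: mult_left_mono emeasure_mono)
  also have "\<dots> = ennreal (r\<^sup>2)"
    using emeasure_ball[OF assms, of a] assms by (simp add: unit_ball_vol_2 flip: ennreal_mult)
  finally show ?thesis .
qed

lemma one_minus_norm_le:
  fixes z w :: complex
  assumes "norm w \<le> 1"
  shows "1 - norm z \<le> norm (1 - z * cnj w)"
proof -
  have "norm (z * cnj w) \<le> norm z * 1"
    unfolding norm_mult using assms by (intro mult_left_mono) auto
  moreover have "1 - norm (z * cnj w) \<le> norm (1 - z * cnj w)"
    using norm_triangle_ineq2[of 1 "z * cnj w"] by simp
  ultimately show ?thesis by simp
qed

lemma norm_lebesgue_integral_le:
  fixes f :: "'a \<Rightarrow> 'b::{banach, second_countable_topology}"
  assumes "integrable M f" "integrable M g" "\<And>x. x \<in> space M \<Longrightarrow> norm (f x) \<le> g x"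
  shows "norm (LINT x|M. f x) \<le> (LINT x|M. g x)"
  using assms by (intro order_trans[OF integral_norm_bound] integral_mono) auto

lemma norm_mult_cnj_less:
  assumes "norm z < 1" "norm w < 1"
  shows "norm (z * cnj w) < 1" "norm (z * cnj w) \<le> norm z"
proof -
  have "norm z * norm w \<le> norm z * 1"
    using assms by (intro mult_left_mono) auto
  then show "norm (z * cnj w) < 1" "norm (z * cnj w) \<le> norm z"
    using assms by (auto simp: norm_mult)
qed

lemma one_minus_mult_cnj_pos:
  assumes "norm z < 1" "w \<in> space disc_area"
  shows "0 < norm (1 - z * cnj w)"
  using one_minus_norm_le[of w z] assms by auto

text \<open>
  For \<open>1 / 2 \<le> \<bar>z\<bar>\<close> the set lies in the ball of radius \<open>s / \<bar>z\<bar>\<close> about the reflection of \<open>z\<close> in the unit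
  circle; for smaller \<open>\<bar>z\<bar>\<close> it is empty unless \<open>s > 1 / 2\<close>.
\<close>
lemma emeasure_disc_area_one_minus_less:
  assumes z: "z \<in> ball 0 1" and s: "0 < s"
  shows "emeasure disc_area {w \<in> space disc_area. norm (1 - z * cnj w) < s} \<le> ennreal (4 * s powr 2)"
proof (cases "1 / 2 \<le> norm z")
  case True
  have "{w \<in> space disc_area. norm (1 - z * cnj w) < s} \<subseteq> ball (cnj (1 / z)) (2 * s) \<inter> ball 0 1"
  proof safe
    fix w assume w: "w \<in> space disc_area" "norm (1 - z * cnj w) < s"
    have "z \<noteq> 0" using True by auto
    then have "1 - z * cnj w = z * cnj (cnj (1 / z) - w)"
      by (simp add: algebra_simps)
    then have "norm (1 - z * cnj w) = norm z * dist (cnj (1 / z)) w"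
      by (simp only: norm_mult complex_mod_cnj dist_norm)
    moreover have "1 / 2 * dist (cnj (1 / z)) w \<le> norm z * dist (cnj (1 / z)) w"
      using True by (intro mult_right_mono) auto
    ultimately show "w \<in> ball (cnj (1 / z)) (2 * s)"
      using w by auto
    show "w \<in> ball 0 1" using w by simp
  qed
  then have "emeasure disc_area {w \<in> space disc_area. norm (1 - z * cnj w) < s}
      \<le> emeasure disc_area (ball (cnj (1 / z)) (2 * s) \<inter> ball 0 1)"
    by (intro emeasure_mono sets_disc_area_ball) auto
  also have "\<dots> \<le> ennreal ((2 * s)\<^sup>2)"
    using s by (intro emeasure_disc_area_Int_ball_le) auto
  finally show ?thesis
    using s by (simp add: powr_numeral power2_eq_square)
next
  case False
  show ?thesis
  proof (cases "s \<le> 1 / 2")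
    case True
    have "s \<le> norm (1 - z * cnj w)" if "w \<in> space disc_area" for w
      using one_minus_norm_le[of w z] that False True by simp
    then have "{w \<in> space disc_area. norm (1 - z * cnj w) < s} = {}"
      by (force simp: not_less simp del: space_disc_area)
    then show ?thesis by (simp only: emeasure_empty zero_le)
  next
    case s2: False
    have "emeasure disc_area {w \<in> space disc_area. norm (1 - z * cnj w) < s} \<le> 1"
      using emeasure_space[of disc_area "{w \<in> space disc_area. norm (1 - z * cnj w) < s}"]
      by (simp add: emeasure_disc_area_ball)
    also have "1 \<le> ennreal (4 * s powr 2)"
    proof -
      have "(1 / 2) * (1 / 2) \<le> s * s"
        using s2 by (intro mult_mono) auto
      then show ?thesis
        using s by (simp add: powr_numeral power2_eq_square)
    qed
    finally show ?thesis .
  qed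
qed

lemma borel_measurable_one_minus:
  "(\<lambda>w. norm (1 - z * cnj w)) \<in> borel_measurable disc_area"
  by (intro borel_measurable_disc_area_continuous continuous_intros)

lemma borel_measurable_one_minus_powr [measurable]:
  "(\<lambda>w. ennreal (norm (1 - z * cnj w) powr q)) \<in> borel_measurable disc_area"
  by (rule measurable_compose[OF borel_measurable_one_minus]) measurable

lemma disc_integral_one_minus_powr_le:
  assumes z: "z \<in> ball 0 1" and q: "2 < q"
  shows "(\<integral>\<^sup>+w. ennreal (norm (1 - z * cnj w) powr -q) \<partial>disc_area)
           \<le> ennreal (4 * 2 powr 2 / (1 - 2 powr (2 - q)) * (1 - norm z) powr (2 - q))"
  using z q
  by (intro nn_integral_negative_power_le emeasure_disc_area_one_minus_less one_minus_norm_le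
      borel_measurable_one_minus) auto

section \<open>The differentiated kernel\<close>

text \<open>
  The derivative in \<open>u\<close> of \<open>1 / ((1 - u) (1 - r u))\<close>.
\<close>
definition kernel_deriv :: "real \<Rightarrow> complex \<Rightarrow> complex" where
  "kernel_deriv r u =
     1 / ((1 - u)\<^sup>2 * (1 - of_real r * u)) + of_real r / ((1 - u) * (1 - of_real r * u)\<^sup>2)"

lemma one_minus_mult_norm_le:
  assumes "0 \<le> r" "norm u \<le> \<rho>"
  shows "1 - r * \<rho> \<le> norm (1 - of_real r * u :: complex)"
proof -
  have "norm (of_real r * u) \<le> r * \<rho>"
    unfolding norm_mult using assms by (simp add: mult_left_mono)
  then show ?thesis
    using norm_triangle_ineq2[of 1 "of_real r * u"] by simp
qed

lemma one_minus_mult_pos: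
  assumes "r \<in> {0..1}" "\<rho> < 1"
  shows "0 < 1 - r * (\<rho>::real)"
proof -
  have "r * \<rho> < 1"
  proof (cases "\<rho> \<le> 0")
    case True
    then have "r * \<rho> \<le> 0" using assms by (auto intro: mult_nonneg_nonpos)
    then show ?thesis by simp
  next
    case False
    then have "r * \<rho> \<le> 1 * \<rho>" using assms by (intro mult_right_mono) auto
    then show ?thesis using assms by simp
  qed
  then show ?thesis by simp
qed

lemma norm_one_minus_le:
  assumes "r \<in> {0..1}" "norm u \<le> 1"
  shows "norm (1 - u) \<le> 2 * norm (1 - of_real r * u :: complex)"
proof -
  have "norm (1 - u) \<le> norm (1 - of_real r * u) + norm ((1 - of_real r) * u)"
    using norm_triangle_ineq4[of "1 - of_real r * u" "(1 - of_real r) * u"]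
    by (simp add: algebra_simps)
  also have "norm ((1 - of_real r) * u) \<le> 1 - r"
  proof -
    have "norm (1 - of_real r :: complex) = 1 - r"
      using assms by (metis abs_of_nonneg atLeastAtMost_iff diff_ge_0_iff_ge norm_of_real of_real_1 of_real_diff)
    then show ?thesis
      unfolding norm_mult using assms by (simp add: mult_left_le)
  qed
  also have "1 - r \<le> norm (1 - of_real r * u)"
    using one_minus_mult_norm_le[of r u 1] assms by simp
  finally show ?thesis by simp
qed

lemma
  assumes r: "r \<in> {0..1}" and u: "norm u \<le> \<rho>" "\<rho> < 1"
  shows norm_kernel_deriv_le_cube: "norm (kernel_deriv r u) \<le> 6 / norm (1 - u) ^ 3"
    and norm_kernel_deriv_le_square:
      "norm (kernel_deriv r u) \<le> 3 / (norm (1 - u))\<^sup>2 * (1 / (1 - r * \<rho>))"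
proof -
  define a b m where "a = norm (1 - u)" and "b = norm (1 - of_real r * u)" and "m = 1 - r * \<rho>"
  have m: "0 < m" "m \<le> b"
    using one_minus_mult_norm_le[of r u \<rho>] one_minus_mult_pos[of r \<rho>] r u by (auto simp: m_def b_def)
  then have b: "0 < b" by simp
  have a: "0 < a" "a / 2 \<le> b"
    using u norm_one_minus_le[of r u] r by (auto simp: a_def b_def)
  have "norm (kernel_deriv r u) \<le> 1 / (a\<^sup>2 * b) + r / (a * b\<^sup>2)"
    unfolding kernel_deriv_def a_def b_def using r
    by (intro order_trans[OF norm_triangle_ineq]) (auto simp: norm_divide norm_mult norm_power)
  also have "r / (a * b\<^sup>2) \<le> 1 / (a * b\<^sup>2)"
    using r a b by (intro divide_right_mono) auto
  finally have le: "norm (kernel_deriv r u) \<le> 1 / (a\<^sup>2 * b) + 1 / (a * b\<^sup>2)" by simp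
  have "1 / (a\<^sup>2 * b) \<le> 1 / (a\<^sup>2 * (a / 2))" "1 / (a * b\<^sup>2) \<le> 1 / (a * (a / 2)\<^sup>2)"
    using a b by (intro divide_left_mono mult_left_mono power_mono mult_pos_pos; simp)+
  moreover have "1 / (a\<^sup>2 * (a / 2)) + 1 / (a * (a / 2)\<^sup>2) = 6 / a ^ 3"
    using a by (simp add: power2_eq_square power3_eq_cube field_simps)
  ultimately show "norm (kernel_deriv r u) \<le> 6 / norm (1 - u) ^ 3"
    using le by (simp add: a_def)
  have "1 / (a\<^sup>2 * b) \<le> 1 / (a\<^sup>2 * m)" "1 / (a * b\<^sup>2) \<le> 1 / (a * ((a / 2) * m))"
    unfolding power2_eq_square[of b]
    using a b m by (intro divide_left_mono mult_left_mono mult_mono mult_pos_pos; simp)+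
  moreover have "1 / (a\<^sup>2 * m) + 1 / (a * ((a / 2) * m)) = 3 / a\<^sup>2 * (1 / m)"
    using a m by (simp add: power2_eq_square field_simps)
  ultimately show "norm (kernel_deriv r u) \<le> 3 / (norm (1 - u))\<^sup>2 * (1 / (1 - r * \<rho>))"
    using le by (simp add: a_def m_def)
qed

lemma norm_kernel_deriv_le_unif:
  assumes "r \<in> {0..1}" "norm u \<le> \<rho>" "\<rho> < 1"
  shows "norm (kernel_deriv r u) \<le> 6 / (1 - \<rho>) ^ 3"
proof -
  have "1 - \<rho> \<le> norm (1 - u)"
    using one_minus_mult_norm_le[of 1 u \<rho>] assms by simp
  then have "6 / norm (1 - u) ^ 3 \<le> 6 / (1 - \<rho>) ^ 3"
    using assms by (intro divide_left_mono power_mono mult_pos_pos zero_less_power) auto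
  with norm_kernel_deriv_le_cube[OF assms] show ?thesis by simp
qed

lemma one_minus_mult_nonzero:
  assumes "r \<in> {0..1}" "norm u < 1"
  shows "1 - of_real r * u \<noteq> (0::complex)" "1 - u \<noteq> 0"
  using one_minus_mult_norm_le[of r u "norm u"] one_minus_mult_pos[of r "norm u"] assms by auto

lemma has_field_derivative_kernel:
  assumes "r \<in> {0..1}" "norm u < 1"
  shows "((\<lambda>u. 1 / ((1 - u) * (1 - of_real r * u))) has_field_derivative kernel_deriv r u) (at u)"
  using one_minus_mult_nonzero[OF assms] unfolding kernel_deriv_def
  by (auto intro!: derivative_eq_intros simp: divide_simps) (simp add: algebra_simps power2_eq_square)?

lemma norm_kernel_le:
  assumes "r \<in> {0..1}" "norm u < 1"
  shows "norm (1 / ((1 - u) * (1 - of_real r * u)) :: complex) \<le> 1 / (1 - norm u)\<^sup>2"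
proof -
  have "1 - norm u \<le> norm (1 - of_real r * u)"
    using one_minus_mult_norm_le[of r u "norm u"] assms
    by (smt (verit) atLeastAtMost_iff mult_left_le_one_le norm_ge_zero)
  moreover have "1 - norm u \<le> norm (1 - u)"
    using one_minus_mult_norm_le[of 1 u "norm u"] by simp
  ultimately show ?thesis
    unfolding norm_divide norm_mult power2_eq_square norm_one using assms
    by (intro divide_left_mono mult_mono mult_pos_pos) auto
qed

text \<open>
  The next two lemmas give the lower bound for the kernel near a point \<open>\<rho>\<close> with \<open>1 / 2 \<le> \<rho> < 1\<close>. The
  factors \<open>cnj w\<close>, \<open>1 - \<rho> * cnj w\<close> and \<open>1 - r * \<rho> * cnj w\<close> are positive at \<open>w = \<rho>\<close>, and for
  \<open>\<bar>w - \<rho>\<bar> \<le> (1 - \<rho>) / 20\<close> each of them changes by a relative error of at most \<open>1 / 20\<close>.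
\<close>
lemma Re_perturbation_ge_half:
  fixes e0 e1 e2 :: complex
  assumes "norm e0 \<le> 1 / 20" "norm e1 \<le> 1 / 20" "norm e2 \<le> 1 / 20"
  shows "1 / 2 \<le> Re ((1 + e0) / ((1 + e1)\<^sup>2 * (1 + e2)))"
proof -
  define P where "P = (1 + e1)\<^sup>2 * (1 + e2)"
  have P1: "norm (P - 1) \<le> 1 / 6"
  proof -
    have "P - 1 = e1 * (2 + e1) * (1 + e2) + e2"
      by (simp add: P_def power2_eq_square algebra_simps)
    also have "norm \<dots> \<le> norm e1 * norm (2 + e1) * norm (1 + e2) + norm e2"
      by (metis norm_mult norm_triangle_ineq)
    also have "\<dots> \<le> (1 / 20) * (41 / 20) * (21 / 20) + 1 / 20"
      using assms norm_triangle_ineq[of 2 e1] norm_triangle_ineq[of 1 e2]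
      by (intro add_mono mult_mono) auto
    finally show ?thesis by simp
  qed
  have nP: "5 / 6 \<le> norm P"
    using norm_triangle_ineq2[of 1 "1 - P"] P1 by (simp add: norm_minus_commute)
  have "P \<noteq> 0" using nP by auto
  then have "(1 + e0) / P - 1 = (e0 - (P - 1)) / P"
    by (simp add: field_simps)
  then have "norm ((1 + e0) / P - 1) = norm (e0 - (P - 1)) / norm P"
    by (simp add: norm_divide)
  also have "\<dots> \<le> (1 / 20 + 1 / 6) / (5 / 6)"
    using nP P1 assms norm_triangle_ineq4[of e0 "P - 1"] by (intro frac_le) auto
  also have "\<dots> \<le> 1 / 2" by simp
  finally have "norm ((1 + e0) / P - 1) \<le> 1 / 2" .
  then show ?thesis
    using abs_Re_le_cmod[of "(1 + e0) / P - 1"] by (simp add: P_def[symmetric])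
qed

lemma Re_cnj_mult_kernel_deriv_ge:
  assumes r: "r \<in> {0..1}" and \<rho>: "1 / 2 \<le> \<rho>" "\<rho> < 1"
    and w: "norm (w - of_real \<rho>) \<le> (1 - \<rho>) / 20"
  shows "1 / (32 * (1 - \<rho>)\<^sup>2) * (1 / (1 - r * \<rho>))
           \<le> Re (cnj w * kernel_deriv r (of_real \<rho> * cnj w))"
proof -
  define d :: complex where "d = cnj w - of_real \<rho>"
  have d: "norm d \<le> (1 - \<rho>) / 20"
    using w by (metis complex_cnj_complex_of_real complex_cnj_diff complex_mod_cnj d_def)
  define a b where "a = 1 - \<rho>\<^sup>2" and "b = 1 - r * \<rho>\<^sup>2"
  have \<rho>2: "\<rho>\<^sup>2 \<le> \<rho>" "r * \<rho>\<^sup>2 \<le> \<rho>\<^sup>2" "0 \<le> r * \<rho>\<^sup>2"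
    using r \<rho> by (auto simp: power2_eq_square mult_left_le_one_le)
  then have a: "1 - \<rho> \<le> a" and b: "1 - \<rho> \<le> b"
    by (auto simp: a_def b_def)
  then have pos: "0 < a" "0 < b" using \<rho> by auto
  define e0 e1 e2 where "e0 = d / of_real \<rho>" and "e1 = - (of_real \<rho> * d) / of_real a"
    and "e2 = - (of_real (r * \<rho>) * d) / of_real b"
  \<comment> \<open>The first error uses \<open>1 - \<rho> \<le> \<rho>\<close>, the other two \<open>1 - \<rho> \<le> a, b\<close>.\<close>
  have e0: "norm e0 \<le> 1 / 20"
    using d \<rho> by (simp add: e0_def norm_divide divide_le_eq)
  have small: "norm (- (of_real s * d) / of_real t) \<le> 1 / 20"
    if "0 \<le> s" "s \<le> 1" "1 - \<rho> \<le> t" for s t :: real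
  proof -
    have "s * norm d \<le> 1 * ((1 - \<rho>) / 20)"
      using that d by (intro mult_mono) auto
    then have "s * norm d \<le> t / 20" using that by simp
    then show ?thesis
      using that \<rho> by (simp add: norm_divide norm_mult divide_le_eq)
  qed
  have e1: "norm e1 \<le> 1 / 20" unfolding e1_def using \<rho> a by (intro small) auto
  have e2: "norm e2 \<le> 1 / 20" unfolding e2_def using \<rho> b r
    by (intro small) (auto simp: mult_le_one)
  have w_eq: "cnj w = of_real \<rho> * (1 + e0)"
    using \<rho> by (simp add: e0_def d_def field_simps)
  have a_eq: "1 - of_real \<rho> * cnj w = of_real a * (1 + e1)"
  proof -
    have "of_real a * (1 + e1) = of_real a - of_real \<rho> * d"
      using pos by (simp add: e1_def ring_distribs)
    then show ?thesis
      by (simp add: a_def d_def power2_eq_square algebra_simps)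
  qed
  have b_eq: "1 - of_real r * (of_real \<rho> * cnj w) = of_real b * (1 + e2)"
  proof -
    have "of_real b * (1 + e2) = of_real b - of_real (r * \<rho>) * d"
      using pos by (simp add: e2_def ring_distribs)
    then show ?thesis
      by (simp add: b_def d_def power2_eq_square algebra_simps)
  qed
  have split: "x * E * (1 / ((p * F)\<^sup>2 * (q * G)) + y / ((p * F) * (q * G)\<^sup>2))
      = x / (p\<^sup>2 * q) * (E / (F\<^sup>2 * G)) + y * x / (q\<^sup>2 * p) * (E / (G\<^sup>2 * F))"
    for x y p q E F G :: complex
    by (simp add: power_mult_distrib distrib_left mult_ac)
  have "cnj w * kernel_deriv r (of_real \<rho> * cnj w)
      = of_real (\<rho> / (a\<^sup>2 * b)) * ((1 + e0) / ((1 + e1)\<^sup>2 * (1 + e2)))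
        + of_real (r * \<rho> / (b\<^sup>2 * a)) * ((1 + e0) / ((1 + e2)\<^sup>2 * (1 + e1)))"
    unfolding kernel_deriv_def
    unfolding a_eq b_eq
    by (subst w_eq) (simp only: split of_real_divide of_real_mult of_real_power)
  then have "Re (cnj w * kernel_deriv r (of_real \<rho> * cnj w))
      = \<rho> / (a\<^sup>2 * b) * Re ((1 + e0) / ((1 + e1)\<^sup>2 * (1 + e2)))
        + r * \<rho> / (b\<^sup>2 * a) * Re ((1 + e0) / ((1 + e2)\<^sup>2 * (1 + e1)))"
    by (simp only: plus_complex.sel times_complex.sel Re_complex_of_real Im_complex_of_real mult_zero_left diff_zero)
  also have "\<dots> \<ge> \<rho> / (a\<^sup>2 * b) * (1 / 2) + 0"
    using r \<rho> pos Re_perturbation_ge_half[OF e0 e1 e2] Re_perturbation_ge_half[OF e0 e2 e1]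
    by (intro add_mono mult_left_mono mult_nonneg_nonneg) auto
  finally have ge: "\<rho> / (2 * (a\<^sup>2 * b)) \<le> Re (cnj w * kernel_deriv r (of_real \<rho> * cnj w))"
    by simp
  have "a \<le> 2 * (1 - \<rho>)"
  proof -
    have "0 \<le> (1 - \<rho>)\<^sup>2" by simp
    then show ?thesis by (simp add: a_def power2_eq_square algebra_simps)
  qed
  then have "a\<^sup>2 \<le> (2 * (1 - \<rho>))\<^sup>2"
    using pos by (intro power_mono) auto
  moreover have rp: "0 < 1 - r * \<rho>"
    using one_minus_mult_pos[OF r \<rho>(2)] .
  moreover have "b \<le> 2 * (1 - r * \<rho>)"
  proof -
    have "r * (\<rho> * (1 - \<rho>)) \<le> 1 * (1 * (1 - \<rho>))"
      using r \<rho> by (intro mult_mono) auto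
    moreover have "r * \<rho> \<le> 1 * \<rho>" using r \<rho> by (intro mult_right_mono) auto
    ultimately show ?thesis by (simp add: b_def power2_eq_square algebra_simps)
  qed
  ultimately have "a\<^sup>2 * b \<le> (2 * (1 - \<rho>))\<^sup>2 * (2 * (1 - r * \<rho>))"
    using pos by (intro mult_mono) auto
  then have "(1 / 2) / (2 * ((2 * (1 - \<rho>))\<^sup>2 * (2 * (1 - r * \<rho>)))) \<le> \<rho> / (2 * (a\<^sup>2 * b))"
    using \<rho> pos rp by (intro frac_le) auto
  also have "(1 / 2) / (2 * ((2 * (1 - \<rho>))\<^sup>2 * (2 * (1 - r * \<rho>))))
      = 1 / (32 * (1 - \<rho>)\<^sup>2) * (1 / (1 - r * \<rho>))"
  proof -
    have "(1 / 2) / (2 * ((2 * x)\<^sup>2 * (2 * y))) = 1 / (32 * x\<^sup>2) * (1 / y)" for x y :: real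
      by (simp add: power_mult_distrib)
    then show ?thesis .
  qed
  finally show ?thesis
    using ge by (rule order_trans)
qed

section \<open>The operator and its derivative\<close>

text \<open>
  Finite Borel measures on \<open>[0,1]\<close>.
\<close>
locale unit_interval_measure = finite_measure \<nu> for \<nu> :: "real measure" +
  assumes sets_nu: "sets \<nu> = sets (restrict_space borel {0..1})"
begin

lemma space_nu: "space \<nu> = {0..1}"
  using sets_eq_imp_space_eq[OF sets_nu] by (simp add: space_restrict_space)

lemma borel_measurable_nu: "f \<in> borel_measurable borel \<Longrightarrow> f \<in> borel_measurable \<nu>"
  using measurable_restrict_space1[of f borel borel "{0..1}"] measurable_cong_sets[OF sets_nu refl]
  by blast

text \<open>
  The total mass of \<open>\<nu>\<close>.
\<close>
definition mass :: real where
  "mass = measure \<nu> (space \<nu>)"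

text \<open>
  The kernel of \<open>T\<close>, which depends on \<open>z\<close> and \<open>w\<close> only through \<open>u = z * cnj w\<close>, and, as
  \<open>has_field_derivative_ker\<close> shows, its derivative in \<open>u\<close>. Both are used for \<open>\<bar>u\<bar> < 1\<close>.
\<close>
definition ker :: "complex \<Rightarrow> complex" where
  "ker u = (LINT r|\<nu>. 1 / ((1 - u) * (1 - of_real r * u)))"

definition ker' :: "complex \<Rightarrow> complex" where
  "ker' u = (LINT r|\<nu>. kernel_deriv r u)"

text \<open>
  The function that controls the kernel, used for \<open>\<rho> < 1\<close>, where the integrand is bounded.
\<close>
definition kappa :: "real \<Rightarrow> real" where
  "kappa \<rho> = (LINT r|\<nu>. 1 / (1 - r * \<rho>))"

lemma kernel_measurable [measurable]:
  "(\<lambda>r. 1 / ((1 - u) * (1 - of_real r * u)) :: complex) \<in> borel_measurable \<nu>"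
  "(\<lambda>r. kernel_deriv r u) \<in> borel_measurable \<nu>"
  "(\<lambda>r. 1 / (1 - r * \<rho>) :: real) \<in> borel_measurable \<nu>"
  unfolding kernel_deriv_def by (intro borel_measurable_nu; measurable)+

lemma integrable_kernel:
  assumes "norm (u::complex) < 1"
  shows "integrable \<nu> (\<lambda>r. 1 / ((1 - u) * (1 - of_real r * u)))"
  using norm_kernel_le[OF _ assms]
  by (intro integrable_const_bound[where B = "1 / (1 - norm u)\<^sup>2"] AE_I2) (auto simp: space_nu)

lemma integrable_kernel_deriv:
  assumes "norm (u::complex) < 1"
  shows "integrable \<nu> (\<lambda>r. kernel_deriv r u)"
  using norm_kernel_deriv_le_unif[OF _ order_refl assms]
  by (intro integrable_const_bound[where B = "6 / (1 - norm u) ^ 3"] AE_I2) (auto simp: space_nu)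

lemma integrable_kappa:
  assumes "\<rho> < 1"
  shows "integrable \<nu> (\<lambda>r. 1 / (1 - r * \<rho>))"
proof (cases "\<rho> \<le> 0")
  case True
  have "norm (1 / (1 - r * \<rho>)) \<le> 1" if "r \<in> {0..1}" for r
    using mult_nonneg_nonpos[of r \<rho>] that True by (auto simp: divide_le_eq)
  then show ?thesis
    by (intro integrable_const_bound[where B = 1] AE_I2) (auto simp: space_nu)
next
  case False
  have "norm (1 / (1 - r * \<rho>)) \<le> 1 / (1 - \<rho>)" if "r \<in> {0..1}" for r
  proof -
    have "r * \<rho> \<le> 1 * \<rho>" using that False by (intro mult_right_mono) auto
    then show ?thesis using assms by (auto simp: abs_if intro!: divide_left_mono)
  qed
  then show ?thesis
    by (intro integrable_const_bound[where B = "1 / (1 - \<rho>)"] AE_I2) (auto simp: space_nu)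
qed

lemma kappa_nonneg: "\<rho> < 1 \<Longrightarrow> 0 \<le> kappa \<rho>"
  unfolding kappa_def using one_minus_mult_pos[of _ \<rho>]
  by (intro integral_nonneg_AE AE_I2) (auto simp: space_nu intro: less_imp_le)

lemma mass_nonneg: "0 \<le> mass"
  by (simp add: mass_def)

lemma norm_ker_le:
  assumes "norm u \<le> \<rho>" "\<rho> < 1"
  shows "norm (ker u) \<le> mass / (1 - \<rho>)\<^sup>2"
proof -
  have "norm (ker u) \<le> (LINT r|\<nu>. 1 / (1 - \<rho>)\<^sup>2)"
    unfolding ker_def
  proof (rule norm_lebesgue_integral_le)
    show "norm (1 / ((1 - u) * (1 - of_real r * u))) \<le> 1 / (1 - \<rho>)\<^sup>2" if "r \<in> space \<nu>" for r
    proof -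
      have "norm (1 / ((1 - u) * (1 - of_real r * u))) \<le> 1 / (1 - norm u)\<^sup>2"
        using that assms by (intro norm_kernel_le) (auto simp: space_nu)
      also have "\<dots> \<le> 1 / (1 - \<rho>)\<^sup>2"
        using assms by (intro divide_left_mono power_mono mult_pos_pos zero_less_power) auto
      finally show ?thesis .
    qed
  qed (use assms in \<open>auto intro: integrable_kernel\<close>)
  then show ?thesis by (simp add: mass_def mult.commute)
qed

lemma norm_ker'_le_cube:
  assumes "norm (u::complex) < 1"
  shows "norm (ker' u) \<le> 6 * mass / norm (1 - u) ^ 3"
proof -
  have "norm (ker' u) \<le> (LINT r|\<nu>. 6 / norm (1 - u) ^ 3)"
    unfolding ker'_def using assms norm_kernel_deriv_le_cube[OF _ order_refl assms]
    by (intro norm_lebesgue_integral_le integrable_kernel_deriv) (auto simp: space_nu)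
  then show ?thesis by (simp add: mass_def mult.commute)
qed

lemma norm_ker'_le_unif:
  assumes "norm u \<le> \<rho>" "\<rho> < 1"
  shows "norm (ker' u) \<le> 6 * mass / (1 - \<rho>) ^ 3"
proof -
  have "norm (ker' u) \<le> (LINT r|\<nu>. 6 / (1 - \<rho>) ^ 3)"
    unfolding ker'_def using assms norm_kernel_deriv_le_unif[OF _ assms]
    by (intro norm_lebesgue_integral_le integrable_kernel_deriv) (auto simp: space_nu)
  then show ?thesis by (simp add: mass_def mult.commute)
qed

lemma norm_ker'_le_kappa:
  assumes "norm u \<le> \<rho>" "\<rho> < 1"
  shows "norm (ker' u) \<le> 3 * kappa \<rho> / (norm (1 - u))\<^sup>2"
proof -
  have "norm (ker' u) \<le> (LINT r|\<nu>. 3 / (norm (1 - u))\<^sup>2 * (1 / (1 - r * \<rho>)))"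
    unfolding ker'_def using assms norm_kernel_deriv_le_square[OF _ assms] integrable_kappa[of \<rho>]
    by (intro norm_lebesgue_integral_le integrable_kernel_deriv integrable_mult_right)
       (auto simp: space_nu)
  also have "\<dots> = 3 / (norm (1 - u))\<^sup>2 * kappa \<rho>"
    unfolding kappa_def by (rule integral_mult_right_zero)
  finally show ?thesis by simp
qed

lemma has_field_derivative_ker:
  assumes "norm (u::complex) < 1"
  shows "(ker has_field_derivative ker' u) (at u)"
proof -
  define \<rho> where "\<rho> = (1 + norm u) / 2"
  have \<rho>: "norm u < \<rho>" "\<rho> < 1" using assms by (auto simp: \<rho>_def)
  show ?thesis
    unfolding ker_def ker'_def
  proof (rule has_field_derivative_lebesgue_integral[where S = "ball 0 \<rho>" and B = "\<lambda>_. 6 / (1 - \<rho>) ^ 3"])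
    fix r :: real and y :: complex assume "r \<in> space \<nu>" "y \<in> ball 0 \<rho>"
    with \<rho> show "((\<lambda>u. 1 / ((1 - u) * (1 - of_real r * u))) has_field_derivative kernel_deriv r y) (at y)"
      and "norm (kernel_deriv r y) \<le> 6 / (1 - \<rho>) ^ 3"
      by (auto simp: space_nu intro!: has_field_derivative_kernel norm_kernel_deriv_le_unif)
  qed (use \<rho> in \<open>auto intro!: integrable_kernel\<close>)
qed

lemma continuous_on_ker: "continuous_on (ball 0 1) ker" "continuous_on (ball 0 1) ker'"
proof -
  have "ker holomorphic_on ball 0 1"
    using has_field_derivative_ker by (force simp: holomorphic_on_open)
  moreover from this have "deriv ker holomorphic_on ball 0 1"
    by (intro holomorphic_deriv) auto
  moreover have "deriv ker u = ker' u" if "u \<in> ball 0 1" for u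
    using that has_field_derivative_ker by (intro DERIV_imp_deriv) auto
  ultimately show "continuous_on (ball 0 1) ker" "continuous_on (ball 0 1) ker'"
    using continuous_on_cong[of "ball 0 1" "ball 0 1" "deriv ker" ker']
    by (auto dest!: holomorphic_on_imp_continuous_on)
qed

lemma borel_measurable_ker_mult_cnj:
  assumes "norm z < 1"
  shows "(\<lambda>w. ker (z * cnj w)) \<in> borel_measurable disc_area"
    and "(\<lambda>w. cnj w * ker' (z * cnj w)) \<in> borel_measurable disc_area"
  using assms norm_mult_cnj_less[OF assms]
  by (auto intro!: borel_measurable_disc_area_continuous continuous_intros
      continuous_on_compose2[OF continuous_on_ker(1)] continuous_on_compose2[OF continuous_on_ker(2)])

lemma T_op_eq: "T_op \<nu> f z = (LINT w|disc_area. ker (z * cnj w) * f w)"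
proof -
  have "1 / (1 - z * cnj w) * (LINT r|\<nu>. 1 / (1 - of_real r * z * cnj w)) = ker (z * cnj w)" for w
    unfolding ker_def by (simp flip: integral_mult_right_zero add: mult.assoc)
  then show ?thesis by (simp add: T_op_def)
qed

lemma norm_cnj_mult_ker'_le:
  assumes "norm z \<le> \<rho>" "\<rho> < 1" "norm w < 1"
  shows "norm (cnj w * ker' (z * cnj w)) \<le> 6 * mass / (1 - \<rho>) ^ 3"
proof -
  have "norm (z * cnj w) \<le> \<rho>"
    using norm_mult_cnj_less(2)[of z w] assms by linarith
  then have "norm (cnj w) * norm (ker' (z * cnj w)) \<le> 1 * (6 * mass / (1 - \<rho>) ^ 3)"
    using norm_ker'_le_unif[of "z * cnj w" \<rho>] assms by (intro mult_mono) auto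
  then show ?thesis
    by (simp add: norm_mult)
qed

lemma has_field_derivative_T_op:
  assumes f: "integrable disc_area f" and z: "norm z < 1"
  shows "(T_op \<nu> f has_field_derivative
           (LINT w|disc_area. (cnj w * ker' (z * cnj w)) * f w)) (at z)"
proof -
  define \<rho> where "\<rho> = (1 + norm z) / 2"
  have \<rho>: "norm z < \<rho>" "\<rho> < 1" using z by (auto simp: \<rho>_def)
  have fm: "f \<in> borel_measurable disc_area" using f by auto
  show ?thesis
    unfolding T_op_eq[abs_def]
  proof (rule has_field_derivative_lebesgue_integral
      [where S = "ball 0 \<rho>" and B = "\<lambda>w. 6 * mass / (1 - \<rho>) ^ 3 * norm (f w)"])
    show "z \<in> ball 0 \<rho>" using \<rho> by simp
    show "(\<lambda>w. (cnj w * ker' (z * cnj w)) * f w) \<in> borel_measurable disc_area"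
      using borel_measurable_ker_mult_cnj(2)[OF z] fm by (rule borel_measurable_times)
    show "integrable disc_area (\<lambda>w. 6 * mass / (1 - \<rho>) ^ 3 * norm (f w))"
      using f by auto
    fix y :: complex assume "y \<in> ball 0 \<rho>"
    then have y: "norm y < 1" "norm y < \<rho>" using \<rho> by auto
    show "integrable disc_area (\<lambda>w. ker (y * cnj w) * f w)"
    proof (rule Bochner_Integration.integrable_bound)
      show "integrable disc_area (\<lambda>w. mass / (1 - norm y)\<^sup>2 * norm (f w))"
        using f by auto
      show "(\<lambda>w. ker (y * cnj w) * f w) \<in> borel_measurable disc_area"
        using borel_measurable_ker_mult_cnj(1)[OF y(1)] fm by (rule borel_measurable_times)
      show "AE w in disc_area. norm (ker (y * cnj w) * f w) \<le> norm (mass / (1 - norm y)\<^sup>2 * norm (f w))"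
      proof (rule AE_I2)
        fix w assume "w \<in> space disc_area"
        then have "norm (ker (y * cnj w)) \<le> mass / (1 - norm y)\<^sup>2"
          using norm_mult_cnj_less[OF y(1)] y by (intro norm_ker_le) auto
        then have "norm (ker (y * cnj w) * f w) \<le> mass / (1 - norm y)\<^sup>2 * norm (f w)"
          unfolding norm_mult by (intro mult_right_mono) auto
        then show "norm (ker (y * cnj w) * f w) \<le> norm (mass / (1 - norm y)\<^sup>2 * norm (f w))"
          by (simp only: real_norm_def abs_ge_self order_trans[OF _ abs_ge_self])
      qed
    qed
    fix w :: complex assume w: "w \<in> space disc_area"
    have yw: "norm (y * cnj w) < 1"
      using norm_mult_cnj_less(1)[OF y(1)] w by simp
    show "((\<lambda>y. ker (y * cnj w) * f w) has_field_derivative (cnj w * ker' (y * cnj w)) * f w) (at y)"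
    proof -
      have "((\<lambda>y. ker (y * cnj w)) has_field_derivative ker' (y * cnj w) * cnj w) (at y)"
        by (rule DERIV_chain2[where g = "\<lambda>y. y * cnj w", OF has_field_derivative_ker[OF yw]])
           (auto intro!: derivative_eq_intros)
      from DERIV_cmult_right[OF this, of "f w"] show ?thesis
        by (simp only: mult.commute)
    qed
    show "norm ((cnj w * ker' (y * cnj w)) * f w) \<le> 6 * mass / (1 - \<rho>) ^ 3 * norm (f w)"
      using norm_cnj_mult_ker'_le[of y \<rho> w] w y(2) \<rho>(2)
      unfolding norm_mult[of "cnj w * ker' (y * cnj w)"] by (intro mult_right_mono) auto
  qed auto
qed

text \<open>
  The growth condition on \<open>kappa\<close> through which the boundedness of \<open>T\<close>, the Carleson condition and
  hyperbolic integrability are compared.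
\<close>
definition kappa_bounded :: "real \<Rightarrow> bool" where
  "kappa_bounded \<alpha> \<longleftrightarrow> (\<exists>C. \<forall>\<rho>\<in>{0..<1}. kappa \<rho> \<le> C * (1 - \<rho>) powr (\<alpha> - 1))"

section \<open>Sufficient conditions for boundedness\<close>

text \<open>
  By duality it suffices to bound the \<open>L\<^sup>c\<close> norm of the differentiated kernel by \<open>A / (1 - \<bar>z\<bar>)\<close>.
\<close>
lemma T_bounded_of_kernel_bound:
  assumes c: "1 \<le> c" and A: "0 < A"
    and le: "\<And>z. norm z < 1 \<Longrightarrow>
      (\<integral>\<^sup>+w. ennreal (norm (ker' (z * cnj w)) powr c) \<partial>disc_area) \<le> ennreal ((A / (1 - norm z)) powr c)"
  shows "T_bounded_Lp_Bloch \<nu> (conj_exponent c)"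
proof -
  let ?L = "Lp_norm (conj_exponent c) disc_area"
  define N where "N = mass + 1"
  have N: "0 < N" using mass_nonneg by (simp add: N_def)
  have int: "integrable disc_area f" if f: "f \<in> Lp_space (conj_exponent c) disc_area" for f
    using Lp_pairing_integrable[OF c f, of "\<lambda>_. 1" 1] by (simp add: emeasure_disc_area_ball)
  have at_0: "ennreal (norm (T_op \<nu> f 0)) \<le> ennreal N * ?L f"
    if f: "f \<in> Lp_space (conj_exponent c) disc_area" for f
    unfolding T_op_eq
  \<comment> \<open>At the origin the kernel is the constant \<open>ker 0\<close>, and the disc has mass \<open>1\<close>.\<close>
  proof (rule Lp_pairing_le[OF c f _ N])
    show "(\<lambda>w. ker (0 * cnj w)) \<in> borel_measurable disc_area" by simp
    have "norm (ker 0) \<le> N"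
      using norm_ker_le[of 0 0] by (simp add: N_def)
    then have "norm (ker 0) powr c \<le> N powr c"
      using c by (intro powr_mono2) auto
    then show "(\<integral>\<^sup>+w. ennreal (norm (ker (0 * cnj w)) powr c) \<partial>disc_area) \<le> ennreal (N powr c)"
      by (simp add: emeasure_disc_area_ball ennreal_leI)
  qed
  have deriv_le: "ennreal ((1 - (norm z)\<^sup>2) * norm (deriv (T_op \<nu> f) z)) \<le> ennreal (2 * A) * ?L f"
    if f: "f \<in> Lp_space (conj_exponent c) disc_area" and z: "norm z < 1" for f z
  proof -
    define D where "D = (LINT w|disc_area. (cnj w * ker' (z * cnj w)) * f w)"
    have D: "deriv (T_op \<nu> f) z = D"
      unfolding D_def by (intro DERIV_imp_deriv has_field_derivative_T_op int f z)
    have "(norm z)\<^sup>2 \<le> 1" using z by (simp add: power_le_one)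
    have "ennreal (norm D) \<le> ennreal (A / (1 - norm z)) * ?L f"
      unfolding D_def
    proof (rule Lp_pairing_le[OF c f borel_measurable_ker_mult_cnj(2)[OF z]])
      show "0 < A / (1 - norm z)" using A z by simp
      have "norm (cnj w * ker' (z * cnj w)) powr c \<le> norm (ker' (z * cnj w)) powr c"
        if "w \<in> space disc_area" for w
        using c that by (intro powr_mono2) (auto simp: norm_mult mult_left_le_one_le)
      then have "(\<integral>\<^sup>+w. ennreal (norm (cnj w * ker' (z * cnj w)) powr c) \<partial>disc_area)
          \<le> (\<integral>\<^sup>+w. ennreal (norm (ker' (z * cnj w)) powr c) \<partial>disc_area)"
        by (intro nn_integral_mono ennreal_leI)
      then show "(\<integral>\<^sup>+w. ennreal (norm (cnj w * ker' (z * cnj w)) powr c) \<partial>disc_area)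
          \<le> ennreal ((A / (1 - norm z)) powr c)"
        using le[OF z] by (rule order_trans)
    qed
    then have "ennreal (1 - (norm z)\<^sup>2) * ennreal (norm D)
        \<le> ennreal (1 - (norm z)\<^sup>2) * (ennreal (A / (1 - norm z)) * ?L f)"
      by (rule mult_left_mono) simp
    also have "\<dots> = ennreal ((1 - (norm z)\<^sup>2) * (A / (1 - norm z))) * ?L f"
      using \<open>(norm z)\<^sup>2 \<le> 1\<close> A z by (simp add: ennreal_mult mult.assoc del: times_divide_eq_right)
    also have "(1 - (norm z)\<^sup>2) * (A / (1 - norm z)) = (1 + norm z) * A"
      using z by (simp add: field_simps power2_eq_square)
    also have "ennreal ((1 + norm z) * A) * ?L f \<le> ennreal (2 * A) * ?L f"
      using A z by (intro mult_right_mono ennreal_leI) auto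
    finally show ?thesis
      using \<open>(norm z)\<^sup>2 \<le> 1\<close> by (simp add: D ennreal_mult)
  qed
  have bloch: "bloch_norm (T_op \<nu> f) \<le> ennreal (N + 2 * A) * ?L f"
    if f: "f \<in> Lp_space (conj_exponent c) disc_area" for f
  proof -
    have "bloch_norm (T_op \<nu> f) \<le> ennreal N * ?L f + ennreal (2 * A) * ?L f"
      unfolding bloch_norm_def using at_0[OF f] deriv_le[OF f]
      by (intro add_mono SUP_least) auto
    also have "\<dots> = ennreal (N + 2 * A) * ?L f"
      using N A by (simp add: ennreal_plus distrib_right)
    finally show ?thesis .
  qed
  have "T_op \<nu> f \<in> bloch_space" if f: "f \<in> Lp_space (conj_exponent c) disc_area" for f
  proof -
    have "T_op \<nu> f holomorphic_on ball 0 1"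
      using has_field_derivative_T_op[OF int[OF f]] by (force simp: holomorphic_on_open)
    moreover have "ennreal (N + 2 * A) * ?L f < \<infinity>"
      using f by (simp add: Lp_space_def ennreal_mult_less_top)
    ultimately show ?thesis
      using bloch[OF f] by (simp add: bloch_space_def order.strict_trans1)
  qed
  with bloch show ?thesis
    unfolding T_bounded_Lp_Bloch_def by blast
qed

lemma T_bounded_Linfty_Bloch: "T_bounded_Lp_Bloch \<nu> (conj_exponent 1)"
proof -
  define Q :: real where "Q = 4 * 2 powr 2 / (1 - 2 powr (2 - 3))"
  define A where "A = 6 * mass * Q + 1"
  have Q: "0 \<le> Q"
    by (simp add: Q_def powr_minus)
  then have A: "0 < A"
    using mass_nonneg by (simp add: A_def add_nonneg_pos)
  show ?thesis
  proof (rule T_bounded_of_kernel_bound[OF order_refl A])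
    fix z :: complex assume z: "norm z < 1"
    have "norm (ker' (z * cnj w)) \<le> 6 * mass * norm (1 - z * cnj w) powr -3"
      if w: "w \<in> space disc_area" for w
      using norm_ker'_le_cube[OF norm_mult_cnj_less(1)[of z w]] w z one_minus_mult_cnj_pos[OF z w]
      by (simp add: powr_minus powr_numeral divide_inverse)
    then have "(\<integral>\<^sup>+w. ennreal (norm (ker' (z * cnj w)) powr 1) \<partial>disc_area)
        \<le> (\<integral>\<^sup>+w. ennreal (6 * mass) * ennreal (norm (1 - z * cnj w) powr -3) \<partial>disc_area)"
      using mass_nonneg by (intro nn_integral_mono) (simp add: ennreal_leI flip: ennreal_mult)
    also have "\<dots> = ennreal (6 * mass) * (\<integral>\<^sup>+w. ennreal (norm (1 - z * cnj w) powr -3) \<partial>disc_area)"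
      by (intro nn_integral_cmult borel_measurable_one_minus_powr)
    also have "\<dots> \<le> ennreal (6 * mass) * ennreal (Q * (1 - norm z) powr (2 - 3))"
      unfolding Q_def using z by (intro mult_left_mono disc_integral_one_minus_powr_le) auto
    also have "\<dots> = ennreal (6 * mass * (Q * (1 - norm z) powr (2 - 3)))"
      using mass_nonneg Q by (intro ennreal_mult[symmetric]) auto
    also have "6 * mass * (Q * (1 - norm z) powr (2 - 3)) = (A - 1) / (1 - norm z)"
    proof -
      have "(1 - norm z) powr (2 - 3) = 1 / (1 - norm z)"
        using z by (simp add: powr_minus divide_inverse)
      then show ?thesis by (simp add: A_def)
    qed
    also have "ennreal ((A - 1) / (1 - norm z)) \<le> ennreal ((A / (1 - norm z)) powr 1)"
      using A z by (intro ennreal_leI) (simp add: divide_right_mono)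
    finally show "(\<integral>\<^sup>+w. ennreal (norm (ker' (z * cnj w)) powr 1) \<partial>disc_area)
        \<le> ennreal ((A / (1 - norm z)) powr 1)" .
  qed
qed

lemma T_bounded_of_kappa_bounded:
  assumes c: "1 < c" and kb: "kappa_bounded (2 - 2 / c)"
  shows "T_bounded_Lp_Bloch \<nu> (conj_exponent c)"
proof -
  obtain C where C: "\<And>\<rho>. \<rho> \<in> {0..<1} \<Longrightarrow> kappa \<rho> \<le> C * (1 - \<rho>) powr (2 - 2 / c - 1)"
    using kb unfolding kappa_bounded_def by blast
  define Q where "Q = 4 * 2 powr 2 / (1 - 2 powr (2 - 2 * c))"
  define K where "K = \<bar>C\<bar> + 1"
  have K: "0 < K" by (simp add: K_def)
  have Q: "0 < Q" using c by (auto simp: Q_def powr_less_one)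
  define A where "A = 3 * K * Q powr (1 / c)"
  have A: "0 < A" using K Q by (simp add: A_def)
  show ?thesis
  proof (rule T_bounded_of_kernel_bound[OF less_imp_le[OF c] A])
    fix z :: complex assume z: "norm z < 1"
    define \<delta> where "\<delta> = 1 - norm z"
    have \<delta>: "0 < \<delta>" using z by (simp add: \<delta>_def)
    define k where "k = 3 * (K * \<delta> powr (1 - 2 / c))"
    have k: "0 < k" using K \<delta> by (simp add: k_def)
    have "kappa (norm z) \<le> C * \<delta> powr (1 - 2 / c)"
      using C[of "norm z"] z by (simp add: \<delta>_def algebra_simps)
    also have "\<dots> \<le> K * \<delta> powr (1 - 2 / c)"
      by (intro mult_right_mono) (auto simp: K_def)
    finally have kz: "3 * kappa (norm z) \<le> k" by (simp add: k_def)
    have "norm (ker' (z * cnj w)) powr c \<le> k powr c * norm (1 - z * cnj w) powr - (2 * c)"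
      if w: "w \<in> space disc_area" for w
    proof -
      note pos = one_minus_mult_cnj_pos[OF z w]
      have "norm (ker' (z * cnj w)) \<le> 3 * kappa (norm z) / (norm (1 - z * cnj w))\<^sup>2"
        using z w norm_mult_cnj_less(2)[of z w] by (intro norm_ker'_le_kappa) auto
      also have "\<dots> \<le> k / (norm (1 - z * cnj w))\<^sup>2"
        using kz by (intro divide_right_mono) auto
      also have "\<dots> = k * norm (1 - z * cnj w) powr -2"
        using pos by (simp add: powr_minus powr_numeral divide_inverse)
      finally have "norm (ker' (z * cnj w)) powr c \<le> (k * norm (1 - z * cnj w) powr -2) powr c"
        using c by (intro powr_mono2) auto
      also have "\<dots> = k powr c * norm (1 - z * cnj w) powr - (2 * c)"
        by (simp only: powr_mult powr_powr mult_minus_left)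
      finally show ?thesis .
    qed
    then have "(\<integral>\<^sup>+w. ennreal (norm (ker' (z * cnj w)) powr c) \<partial>disc_area)
        \<le> (\<integral>\<^sup>+w. ennreal (k powr c) * ennreal (norm (1 - z * cnj w) powr - (2 * c)) \<partial>disc_area)"
      by (intro nn_integral_mono) (simp add: ennreal_leI flip: ennreal_mult)
    also have "\<dots> = ennreal (k powr c) * (\<integral>\<^sup>+w. ennreal (norm (1 - z * cnj w) powr - (2 * c)) \<partial>disc_area)"
      by (intro nn_integral_cmult borel_measurable_one_minus_powr)
    also have "\<dots> \<le> ennreal (k powr c) * ennreal (Q * \<delta> powr (2 - 2 * c))"
      unfolding Q_def \<delta>_def using z c by (intro mult_left_mono disc_integral_one_minus_powr_le) auto
    also have "\<dots> = ennreal (k powr c * (Q * \<delta> powr (2 - 2 * c)))"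
      using Q by (intro ennreal_mult[symmetric]) auto
    \<comment> \<open>The exponents of \<open>\<delta>\<close> add up to \<open>(c - 2) + (2 - 2 * c) = -c\<close>.\<close>
    also have "k powr c * (Q * \<delta> powr (2 - 2 * c)) = (A / (1 - norm z)) powr c"
    proof -
      have 1: "(\<delta> powr (1 - 2 / c)) powr c = \<delta> powr (c - 2)"
        using c by (simp add: powr_powr left_diff_distrib)
      have 2: "\<delta> powr (c - 2) * \<delta> powr (2 - 2 * c) = \<delta> powr -c"
        by (simp add: powr_add[symmetric])
      have 3: "(Q powr (1 / c)) powr c = Q"
        using Q c by (simp add: powr_powr)
      have "k powr c * (Q * \<delta> powr (2 - 2 * c))
          = (3 powr c * K powr c * Q) * (\<delta> powr (c - 2) * \<delta> powr (2 - 2 * c))"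
        unfolding k_def powr_mult 1 by (simp only: mult_ac)
      also have "\<dots> = A powr c * \<delta> powr -c"
        unfolding 2 A_def powr_mult 3 ..
      also have "\<dots> = (A / \<delta>) powr c"
        by (subst powr_divide) (simp only: powr_minus divide_inverse)
      finally show ?thesis by (simp add: \<delta>_def)
    qed
    finally show "(\<integral>\<^sup>+w. ennreal (norm (ker' (z * cnj w)) powr c) \<partial>disc_area)
        \<le> ennreal ((A / (1 - norm z)) powr c)" .
  qed
qed

section \<open>Necessity: testing on a small disc\<close>

lemma kappa_le_of_le_half:
  assumes "0 \<le> \<rho>" "\<rho> \<le> 1 / 2"
  shows "kappa \<rho> \<le> 2 * mass"
proof -
  have "1 / (1 - r * \<rho>) \<le> 2" if "r \<in> space \<nu>" for r
  proof -
    have "r * \<rho> \<le> 1 * (1 / 2)" using that assms by (intro mult_mono) (auto simp: space_nu)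
    then show ?thesis by (simp add: divide_le_eq)
  qed
  then have "kappa \<rho> \<le> (LINT r|\<nu>. 2)"
    unfolding kappa_def using assms by (intro integral_mono integrable_kappa) auto
  then show ?thesis by (simp add: mass_def)
qed

lemma Re_cnj_mult_ker'_ge:
  assumes \<rho>: "1 / 2 \<le> \<rho>" "\<rho> < 1" and w: "norm (w - of_real \<rho>) \<le> (1 - \<rho>) / 20" "norm w < 1"
  shows "kappa \<rho> / (32 * (1 - \<rho>)\<^sup>2) \<le> Re (cnj w * ker' (of_real \<rho> * cnj w))"
proof -
  let ?u = "of_real \<rho> * cnj w"
  have u: "norm ?u < 1" using \<rho> w norm_mult_cnj_less(1)[of "of_real \<rho>" w] by simp
  have int: "integrable \<nu> (\<lambda>r. cnj w * kernel_deriv r ?u)"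
    using integrable_kernel_deriv[OF u] by (rule integrable_mult_right)
  have "kappa \<rho> / (32 * (1 - \<rho>)\<^sup>2) = (LINT r|\<nu>. 1 / (32 * (1 - \<rho>)\<^sup>2) * (1 / (1 - r * \<rho>)))"
    unfolding integral_mult_right_zero kappa_def by simp
  also have "\<dots> \<le> (LINT r|\<nu>. Re (cnj w * kernel_deriv r ?u))"
  proof (rule integral_mono)
    show "integrable \<nu> (\<lambda>r. 1 / (32 * (1 - \<rho>)\<^sup>2) * (1 / (1 - r * \<rho>)))"
      using integrable_kappa[OF \<rho>(2)] by (rule integrable_mult_right)
    show "integrable \<nu> (\<lambda>r. Re (cnj w * kernel_deriv r ?u))"
      using int by (rule integrable_Re)
  qed (use \<rho> w in \<open>intro Re_cnj_mult_kernel_deriv_ge; simp add: space_nu\<close>)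
  also have "\<dots> = Re (cnj w * ker' ?u)"
    unfolding integral_Re[OF int] ker'_def integral_mult_right_zero ..
  finally show ?thesis .
qed

lemma kappa_bounded_of_T_bounded:
  assumes c: "1 < c" "c \<le> 2" and T: "T_bounded_Lp_Bloch \<nu> (conj_exponent c)"
  shows "kappa_bounded (2 - 2 / c)"
proof -
  let ?p = "conj_exponent c"
  obtain C0 where C0: "\<And>f. f \<in> Lp_space ?p disc_area \<Longrightarrow>
      bloch_norm (T_op \<nu> f) \<le> ennreal C0 * Lp_norm ?p disc_area f"
    using T unfolding T_bounded_Lp_Bloch_def by blast
  \<comment> \<open>\<open>C0\<close> may be negative, where \<open>ennreal C0\<close> is \<open>0\<close>.\<close>
  define C where "C = \<bar>C0\<bar>"
  have C: "bloch_norm (T_op \<nu> f) \<le> ennreal C * Lp_norm ?p disc_area f"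
    if "f \<in> Lp_space ?p disc_area" for f
    by (rule order_trans[OF C0[OF that]]) (auto intro!: mult_right_mono ennreal_leI simp: C_def)
  have big: "kappa \<rho> \<le> 12800 * C * (1 - \<rho>) powr (1 - 2 / c)" if \<rho>: "1 / 2 \<le> \<rho>" "\<rho> < 1" for \<rho>
  proof -
    define \<delta> where "\<delta> = 1 - \<rho>"
    define s where "s = \<delta> / 20"
    have \<delta>: "0 < \<delta>" "\<delta> \<le> 1 / 2" and s: "0 < s" using \<rho> by (auto simp: \<delta>_def s_def)
    define B where "B = ball (of_real \<rho> :: complex) s"
    have sub: "B \<subseteq> ball 0 1"
    proof
      fix w assume "w \<in> B"
      then have "norm w < \<rho> + s"
        using norm_triangle_ineq2[of w "of_real \<rho>"] \<rho> by (auto simp: B_def dist_norm norm_minus_commute)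
      moreover have "\<rho> + s < 1"
        using \<rho> by (simp add: s_def \<delta>_def field_simps)
      ultimately show "w \<in> ball 0 1" by simp
    qed
    have B_sets[measurable]: "B \<in> sets disc_area"
      using sets_disc_area_ball[of B] sub by (simp add: B_def Int_absorb2)
    have B_measure: "emeasure disc_area B = ennreal (s\<^sup>2)"
      unfolding B_def using s sub by (intro emeasure_disc_area_subball) (auto simp: B_def)
    define f :: "complex \<Rightarrow> complex" where "f = (\<lambda>w. indicator B w)"
    have fm[measurable]: "f \<in> borel_measurable disc_area"
      unfolding f_def by measurable
    have norm_f: "Lp_norm ?p disc_area f = ennreal ((s\<^sup>2) powr ((c - 1) / c))"
    proof -
      have "(\<integral>\<^sup>+w. ennreal (norm (f w) powr enn2real ?p) \<partial>disc_area) = (\<integral>\<^sup>+w. indicator B w \<partial>disc_area)"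
        using conj_exponent_real(1,5)[OF c(1)]
        by (intro nn_integral_cong) (auto simp: f_def indicator_def)
      also have "\<dots> = ennreal (s\<^sup>2)"
        by (simp add: B_measure)
      finally show ?thesis
        using conj_exponent_real(4,5)[OF c(1)] s by (simp add: Lp_norm_def)
    qed
    have f: "f \<in> Lp_space ?p disc_area"
      using fm norm_f by (simp add: Lp_space_def)
    have fint: "integrable disc_area f"
      by (intro disc_area.integrable_const_bound[where B = 1] AE_I2 fm) (auto simp: f_def indicator_def)
    define D where "D = (LINT w|disc_area. (cnj w * ker' (of_real \<rho> * cnj w)) * f w)"
    have \<rho>1: "norm (of_real \<rho> :: complex) < 1" using \<rho> by simp
    have D: "deriv (T_op \<nu> f) (of_real \<rho>) = D"
      unfolding D_def by (intro DERIV_imp_deriv has_field_derivative_T_op fint \<rho>1)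
    define m where "m = kappa \<rho> / (32 * \<delta>\<^sup>2)"
    have int: "integrable disc_area (\<lambda>w. (cnj w * ker' (of_real \<rho> * cnj w)) * f w)"
    proof (rule Bochner_Integration.integrable_bound)
      show "integrable disc_area (\<lambda>w. 6 * mass / (1 - \<rho>) ^ 3 * norm (f w))"
        using fint by auto
      show "(\<lambda>w. (cnj w * ker' (of_real \<rho> * cnj w)) * f w) \<in> borel_measurable disc_area"
        using borel_measurable_ker_mult_cnj(2)[OF \<rho>1] fm by (rule borel_measurable_times)
      show "AE w in disc_area. norm ((cnj w * ker' (of_real \<rho> * cnj w)) * f w)
          \<le> norm (6 * mass / (1 - \<rho>) ^ 3 * norm (f w))"
      proof (rule AE_I2)
        fix w assume w: "w \<in> space disc_area"
        have "norm (cnj w * ker' (of_real \<rho> * cnj w)) \<le> 6 * mass / (1 - \<rho>) ^ 3"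
          using w \<rho> by (intro norm_cnj_mult_ker'_le) auto
        then have "norm ((cnj w * ker' (of_real \<rho> * cnj w)) * f w) \<le> 6 * mass / (1 - \<rho>) ^ 3 * norm (f w)"
          unfolding norm_mult[of "cnj w * ker' (of_real \<rho> * cnj w)"] by (intro mult_right_mono) auto
        then show "norm ((cnj w * ker' (of_real \<rho> * cnj w)) * f w)
            \<le> norm (6 * mass / (1 - \<rho>) ^ 3 * norm (f w))"
          by (simp only: real_norm_def order_trans[OF _ abs_ge_self])
      qed
    qed
    have "m * s\<^sup>2 = (LINT w|disc_area. m * indicator B w)"
      using B_measure s sub by (simp add: measure_def Int_absorb2)
    also have "\<dots> \<le> (LINT w|disc_area. Re ((cnj w * ker' (of_real \<rho> * cnj w)) * f w))"
    proof (rule integral_mono)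
      show "integrable disc_area (\<lambda>w. m * indicator B w)"
        by (intro integrable_mult_right integrable_real_indicator) (auto simp: B_measure)
      show "integrable disc_area (\<lambda>w. Re ((cnj w * ker' (of_real \<rho> * cnj w)) * f w))"
        using int by (rule integrable_Re)
      fix w assume "w \<in> space disc_area"
      then have "m \<le> Re (cnj w * ker' (of_real \<rho> * cnj w))" if "w \<in> B"
        unfolding m_def \<delta>_def using that \<rho>
        by (intro Re_cnj_mult_ker'_ge) (auto simp: B_def s_def \<delta>_def dist_norm norm_minus_commute)
      then show "m * indicator B w \<le> Re ((cnj w * ker' (of_real \<rho> * cnj w)) * f w)"
        by (auto simp: f_def indicator_def)
    qed
    also have "\<dots> = Re D"
      unfolding D_def using int by (rule integral_Re)
    also have "\<dots> \<le> norm D" by (rule complex_Re_le_cmod)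
    finally have mD: "m * s\<^sup>2 \<le> norm D" .
    have "ennreal ((1 - \<rho>\<^sup>2) * norm D) \<le> bloch_norm (T_op \<nu> f)"
    proof -
      have "ennreal ((1 - (norm (of_real \<rho> :: complex))\<^sup>2) * norm (deriv (T_op \<nu> f) (of_real \<rho>)))
          \<le> (SUP z\<in>ball 0 1. ennreal ((1 - (norm z)\<^sup>2) * norm (deriv (T_op \<nu> f) z)))"
        using \<rho>1 by (intro SUP_upper) auto
      also have "\<dots> \<le> bloch_norm (T_op \<nu> f)"
        by (simp add: bloch_norm_def)
      finally show ?thesis by (simp add: D)
    qed
    also have "\<dots> \<le> ennreal (C * (s\<^sup>2) powr ((c - 1) / c))"
      using C[OF f] by (simp add: norm_f ennreal_mult C_def)
    finally have le: "(1 - \<rho>\<^sup>2) * norm D \<le> C * (s\<^sup>2) powr ((c - 1) / c)"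
      by (simp add: C_def ennreal_le_iff)
    \<comment> \<open>With \<open>s = \<delta> / 20\<close> the left-hand side is \<open>\<delta> * kappa \<rho> / (32 * 400)\<close>.\<close>
    have "\<delta> * (m * s\<^sup>2) \<le> (1 - \<rho>\<^sup>2) * norm D"
    proof (intro mult_mono mD)
      show "\<delta> \<le> 1 - \<rho>\<^sup>2" using \<rho> by (simp add: \<delta>_def power2_eq_square)
      show "0 \<le> 1 - \<rho>\<^sup>2" using \<rho> by (simp add: power_le_one)
      show "0 \<le> m * s\<^sup>2" using kappa_nonneg[OF \<rho>(2)] by (simp add: m_def)
    qed
    with le have "\<delta> * (m * s\<^sup>2) \<le> C * (s\<^sup>2) powr ((c - 1) / c)" by simp
    also have "\<dots> \<le> C * (\<delta>\<^sup>2) powr ((c - 1) / c)"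
      using c \<delta> by (intro mult_left_mono powr_mono2 power_mono) (auto simp: C_def s_def)
    also have "(\<delta>\<^sup>2) powr ((c - 1) / c) = \<delta> powr (2 - 2 / c)"
      using \<delta> c by (simp add: powr_powr diff_divide_distrib right_diff_distrib flip: powr_numeral)
    also have "\<delta> * (m * s\<^sup>2) = \<delta> * kappa \<rho> / 12800"
      using \<delta> by (simp add: m_def s_def power2_eq_square)
    finally have "\<delta> * kappa \<rho> \<le> 12800 * C * \<delta> powr (2 - 2 / c)" by simp
    also have "\<delta> powr (2 - 2 / c) = \<delta> * \<delta> powr (1 - 2 / c)"
      using \<delta> powr_add[of \<delta> 1 "1 - 2 / c"] by simp
    finally show ?thesis
      using \<delta> by (simp add: \<delta>_def mult.left_commute)
  qed
  have "kappa \<rho> \<le> (12800 * C + 2 * mass) * (1 - \<rho>) powr (2 - 2 / c - 1)" if \<rho>: "\<rho> \<in> {0..<1}" for \<rho>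
  proof (cases "1 / 2 \<le> \<rho>")
    case True
    have "kappa \<rho> \<le> 12800 * C * (1 - \<rho>) powr (1 - 2 / c)"
      using big[OF True] \<rho> by simp
    also have "\<dots> \<le> (12800 * C + 2 * mass) * (1 - \<rho>) powr (1 - 2 / c)"
      using mass_nonneg by (intro mult_right_mono) auto
    finally show ?thesis by simp
  next
    case False
    \<comment> \<open>The exponent is at most \<open>0\<close> because \<open>c \<le> 2\<close>.\<close>
    have "1 \<le> (1 - \<rho>) powr (1 - 2 / c)"
    proof -
      have "(1 - \<rho>) powr 0 \<le> (1 - \<rho>) powr (1 - 2 / c)"
        using \<rho> c by (intro powr_mono') auto
      then show ?thesis using \<rho> by simp
    qed
    then have "2 * mass * 1 \<le> (12800 * C + 2 * mass) * (1 - \<rho>) powr (1 - 2 / c)"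
      using mass_nonneg by (intro mult_mono) (auto simp: C_def)
    then show ?thesis
      using kappa_le_of_le_half[of \<rho>] \<rho> False by simp
  qed
  then show ?thesis
    unfolding kappa_bounded_def by blast
qed

section \<open>The growth of kappa, Carleson measures and hyperbolic integrability\<close>

lemma ennreal_kappa:
  assumes "\<rho> < 1"
  shows "ennreal (kappa \<rho>) = (\<integral>\<^sup>+r. ennreal (1 / (1 - r * \<rho>)) \<partial>\<nu>)"
  unfolding kappa_def using integrable_kappa[OF assms] one_minus_mult_pos[of _ \<rho>] assms
  by (intro nn_integral_eq_integral[symmetric] AE_I2) (auto simp: space_nu intro: less_imp_le)

lemma sets_nu_iff: "A \<subseteq> {0..1} \<Longrightarrow> A \<in> sets borel \<Longrightarrow> A \<in> sets \<nu>"
  by (auto simp: sets_nu sets_restrict_space)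

text \<open>
  On \<open>[1 - t, 1)\<close> the integrand of \<open>kappa (1 - t)\<close> is at least \<open>1 / (2 * t)\<close>.
\<close>
lemma carleson_of_kappa_bounded:
  assumes "kappa_bounded \<alpha>"
  shows "carleson_condition \<alpha> \<nu>"
proof -
  obtain C where C: "\<And>\<rho>. \<rho> \<in> {0..<1} \<Longrightarrow> kappa \<rho> \<le> C * (1 - \<rho>) powr (\<alpha> - 1)"
    using assms unfolding kappa_bounded_def by blast
  have "emeasure \<nu> {1 - t..<1} / ennreal (t powr \<alpha>) \<le> ennreal (2 * C)" if t: "t \<in> {0<..1}" for t
  proof -
    let ?S = "{1 - t..<1}"
    have S: "?S \<in> sets \<nu>" using t by (intro sets_nu_iff) auto
    have "ennreal (1 / (2 * t)) * emeasure \<nu> ?S = (\<integral>\<^sup>+r. ennreal (1 / (2 * t)) * indicator ?S r \<partial>\<nu>)"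
      using S by (simp add: nn_integral_cmult_indicator)
    also have "\<dots> \<le> (\<integral>\<^sup>+r. ennreal (1 / (1 - r * (1 - t))) \<partial>\<nu>)"
    proof (rule nn_integral_mono)
      fix r assume r: "r \<in> space \<nu>"
      have "1 / (2 * t) \<le> 1 / (1 - r * (1 - t))" if "r \<in> ?S"
      proof -
        have "(1 - t) * (1 - t) \<le> r * (1 - t)"
          using that t by (intro mult_right_mono) auto
        then have "1 - 2 * t + t * t \<le> r - r * t" by (simp add: algebra_simps)
        then have "1 - r * (1 - t) \<le> 2 * t"
          using zero_le_square[of t] by (simp only: right_diff_distrib mult_1_right)
        moreover have "0 < 1 - r * (1 - t)"
          using r t by (intro one_minus_mult_pos) (auto simp: space_nu)
        ultimately show ?thesis by (intro divide_left_mono mult_pos_pos) (use t in auto)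
      qed
      then show "ennreal (1 / (2 * t)) * indicator ?S r \<le> ennreal (1 / (1 - r * (1 - t)))"
        by (auto simp: indicator_def intro: ennreal_leI)
    qed
    also have "\<dots> = ennreal (kappa (1 - t))"
      using t by (intro ennreal_kappa[symmetric]) auto
    also have "\<dots> \<le> ennreal (C * t powr (\<alpha> - 1))"
      using C[of "1 - t"] t by (intro ennreal_leI) auto
    finally have "ennreal (2 * t) * (ennreal (1 / (2 * t)) * emeasure \<nu> ?S)
        \<le> ennreal (2 * t) * ennreal (C * t powr (\<alpha> - 1))"
      by (rule mult_left_mono) simp
    also have "ennreal (2 * t) * (ennreal (1 / (2 * t)) * emeasure \<nu> ?S) = emeasure \<nu> ?S"
      using t by (simp add: mult.assoc[symmetric] flip: ennreal_mult)
    also have "ennreal (2 * t) * ennreal (C * t powr (\<alpha> - 1)) = ennreal (2 * C) * ennreal (t powr \<alpha>)"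
    proof -
      have "t * t powr (\<alpha> - 1) = t powr \<alpha>"
        using t powr_add[of t 1 "\<alpha> - 1"] by simp
      then have "2 * t * (C * t powr (\<alpha> - 1)) = 2 * C * t powr \<alpha>"
        by (metis mult.assoc mult.left_commute)
      moreover have "ennreal (2 * t * (C * t powr (\<alpha> - 1))) = ennreal (2 * t) * ennreal (C * t powr (\<alpha> - 1))"
        using t by (intro ennreal_mult') auto
      moreover have "ennreal (2 * C * t powr \<alpha>) = ennreal (2 * C) * ennreal (t powr \<alpha>)"
        by (intro ennreal_mult'') auto
      ultimately show ?thesis by (simp only:)
    qed
    finally show ?thesis
      using t by (intro divide_le_posI_ennreal) (auto simp: mult.commute)
  qed
  then have "(SUP t\<in>{0<..1}. emeasure \<nu> {1 - t..<1} / ennreal (t powr \<alpha>)) \<le> ennreal (2 * C)"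
    by (rule SUP_least)
  then show ?thesis
    unfolding carleson_condition_def by (rule order.strict_trans1) simp
qed

text \<open>
  The set where \<open>1 - r * \<rho> < s\<close> lies in \<open>[1 - s, 1]\<close>, so that the Carleson condition, extended to
  \<open>s > 1\<close> by the total mass, controls the sublevel sets needed for the dyadic estimate. The series
  converges because \<open>\<alpha> < 1\<close>.
\<close>
lemma kappa_bounded_of_carleson:
  assumes \<alpha>: "0 < \<alpha>" "\<alpha> < 1" and one: "emeasure \<nu> {1} = 0" and car: "carleson_condition \<alpha> \<nu>"
  shows "kappa_bounded \<alpha>"
proof -
  let ?S = "SUP t\<in>{0<..1}. emeasure \<nu> {1 - t..<1} / ennreal (t powr \<alpha>)"
  define C where "C = enn2real ?S"
  have C: "0 \<le> C" "?S = ennreal C"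
    using car by (auto simp: C_def carleson_condition_def less_top)
  have car_le: "emeasure \<nu> {1 - t..<1} \<le> ennreal (C * t powr \<alpha>)" if t: "0 < t" "t \<le> 1" for t
  proof -
    have "emeasure \<nu> {1 - t..<1} / ennreal (t powr \<alpha>) \<le> ennreal C"
      unfolding C(2)[symmetric] using t by (intro SUP_upper) auto
    then have "emeasure \<nu> {1 - t..<1} / ennreal (t powr \<alpha>) * ennreal (t powr \<alpha>)
        \<le> ennreal C * ennreal (t powr \<alpha>)"
      by (rule mult_right_mono) simp
    then show ?thesis
      using t C(1) by (simp add: ennreal_divide_times ennreal_mult ennreal_times_divide
          mult_divide_eq_ennreal)
  qed
  define K where "K = (C + mass) * 2 powr \<alpha> / (1 - 2 powr (\<alpha> - 1))"
  have "kappa \<rho> \<le> K * (1 - \<rho>) powr (\<alpha> - 1)" if \<rho>: "\<rho> \<in> {0..<1}" for \<rho>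
  proof -
    have dist: "emeasure \<nu> {r \<in> space \<nu>. 1 - r * \<rho> < s} \<le> ennreal ((C + mass) * s powr \<alpha>)"
      if s: "0 < s" for s
    proof (cases "s \<le> 1")
      case True
      have "{r \<in> space \<nu>. 1 - r * \<rho> < s} \<subseteq> {1 - s..<1} \<union> {1}"
      proof
        fix r assume "r \<in> {r \<in> space \<nu>. 1 - r * \<rho> < s}"
        then have r: "0 \<le> r" "r \<le> 1" "1 - r * \<rho> < s" by (auto simp: space_nu)
        have "r * \<rho> \<le> r * 1" using r \<rho> by (intro mult_left_mono) auto
        then show "r \<in> {1 - s..<1} \<union> {1}" using r by auto
      qed
      then have "emeasure \<nu> {r \<in> space \<nu>. 1 - r * \<rho> < s} \<le> emeasure \<nu> ({1 - s..<1} \<union> {1})"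
        using True s by (intro emeasure_mono sets_nu_iff) auto
      also have "\<dots> \<le> emeasure \<nu> {1 - s..<1} + emeasure \<nu> {1}"
        using True s by (intro emeasure_subadditive sets_nu_iff) auto
      also have "\<dots> \<le> ennreal (C * s powr \<alpha>)"
        using car_le[OF s True] one by simp
      also have "\<dots> \<le> ennreal ((C + mass) * s powr \<alpha>)"
        using mass_nonneg by (intro ennreal_leI mult_right_mono) auto
      finally show ?thesis .
    next
      case False
      have "emeasure \<nu> {r \<in> space \<nu>. 1 - r * \<rho> < s} \<le> emeasure \<nu> (space \<nu>)"
        by (rule emeasure_space)
      also have "\<dots> = ennreal mass"
        by (simp add: mass_def emeasure_eq_measure)
      also have "\<dots> \<le> ennreal ((C + mass) * s powr \<alpha>)"
      proof (rule ennreal_leI)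
        have "mass * 1 \<le> (C + mass) * s powr \<alpha>"
          using False C mass_nonneg \<alpha> by (intro mult_mono) (auto simp: ge_one_powr_ge_zero)
        then show "mass \<le> (C + mass) * s powr \<alpha>" by simp
      qed
      finally show ?thesis .
    qed
    have ge: "1 - \<rho> \<le> 1 - r * \<rho>" if "r \<in> space \<nu>" for r
      using that \<rho> by (auto simp: space_nu mult_left_le_one_le)
    have "ennreal (kappa \<rho>) = (\<integral>\<^sup>+r. ennreal ((1 - r * \<rho>) powr -1) \<partial>\<nu>)"
    proof -
      have "1 / (1 - r * \<rho>) = (1 - r * \<rho>) powr -1" if "r \<in> space \<nu>" for r
        using ge[OF that] \<rho> by (simp add: powr_minus divide_inverse)
      moreover have "ennreal (kappa \<rho>) = (\<integral>\<^sup>+r. ennreal (1 / (1 - r * \<rho>)) \<partial>\<nu>)"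
        using \<rho> by (intro ennreal_kappa) auto
      ultimately show ?thesis
        by (simp cong: nn_integral_cong)
    qed
    also have "\<dots> \<le> ennreal ((C + mass) * 2 powr \<alpha> / (1 - 2 powr (\<alpha> - 1)) * (1 - \<rho>) powr (\<alpha> - 1))"
      using \<rho> \<alpha> C(1) mass_nonneg dist ge
      by (intro nn_integral_negative_power_le borel_measurable_nu) auto
    finally have "ennreal (kappa \<rho>) \<le> ennreal (K * (1 - \<rho>) powr (\<alpha> - 1))"
      by (simp add: K_def)
    moreover have "0 \<le> K"
    proof -
      have "2 powr (\<alpha> - 1) < 1" using \<alpha> by (simp add: powr_less_one)
      then show ?thesis using C(1) mass_nonneg by (simp add: K_def)
    qed
    ultimately show ?thesis
      by (simp add: ennreal_le_iff)
  qed
  then show ?thesis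
    unfolding kappa_bounded_def by blast
qed

text \<open>
  Fatou's lemma along \<open>\<rho> n \<rightarrow> 1\<close>.
\<close>
lemma hyperbolically_integrable_of_kappa_bounded:
  assumes "kappa_bounded 1"
  shows "hyperbolically_integrable \<nu>"
proof -
  obtain C where C: "\<And>\<rho>. \<rho> \<in> {0..<1} \<Longrightarrow> kappa \<rho> \<le> C"
  proof -
    from assms obtain C where "\<And>\<rho>. \<rho> \<in> {0..<1} \<Longrightarrow> kappa \<rho> \<le> C * (1 - \<rho>) powr (1 - 1)"
      unfolding kappa_bounded_def by blast
    then show ?thesis by (intro that[of C]) force
  qed
  define \<rho> :: "nat \<Rightarrow> real" where "\<rho> n = 1 - inverse (real (Suc n))" for n
  have \<rho>: "\<rho> n \<in> {0..<1}" for n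
    by (auto simp: \<rho>_def inverse_le_1_iff)
  have lim_\<rho>: "\<rho> \<longlonglongrightarrow> 1"
    unfolding \<rho>_def using tendsto_diff[OF tendsto_const LIMSEQ_inverse_real_of_nat, of 1]
    by (simp only: diff_zero)
  have "(\<integral>\<^sup>+r\<in>{0..<1}. ennreal (1 / (1 - r\<^sup>2)) \<partial>\<nu>)
      \<le> (\<integral>\<^sup>+r. liminf (\<lambda>n. ennreal (1 / (1 - r * \<rho> n))) \<partial>\<nu>)"
  proof (rule nn_integral_mono)
    fix r assume "r \<in> space \<nu>"
    show "ennreal (1 / (1 - r\<^sup>2)) * indicator {0..<1} r \<le> liminf (\<lambda>n. ennreal (1 / (1 - r * \<rho> n)))"
    proof (cases "r \<in> {0..<1}")
      case True
      have "(\<lambda>n. ennreal (1 / (1 - r * \<rho> n))) \<longlonglongrightarrow> ennreal (1 / (1 - r * 1))"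
        using True by (intro tendsto_ennrealI tendsto_intros lim_\<rho>) auto
      then have "liminf (\<lambda>n. ennreal (1 / (1 - r * \<rho> n))) = ennreal (1 / (1 - r * 1))"
        by (intro lim_imp_Liminf) auto
      moreover have "1 / (1 - r\<^sup>2) \<le> 1 / (1 - r * 1)"
      proof (rule divide_left_mono)
        have "r * r \<le> r * 1" "r * r < 1 * 1"
          using True by (intro mult_left_mono mult_strict_mono; simp)+
        then show "1 - r * 1 \<le> 1 - r\<^sup>2" "0 < (1 - r\<^sup>2) * (1 - r * 1)"
          using True by (auto simp: power2_eq_square)
      qed simp
      ultimately show ?thesis
        using True by (simp add: ennreal_leI)
    qed simp
  qed
  also have "\<dots> \<le> liminf (\<lambda>n. \<integral>\<^sup>+r. ennreal (1 / (1 - r * \<rho> n)) \<partial>\<nu>)"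
    by (intro nn_integral_liminf) measurable
  also have "\<dots> = liminf (\<lambda>n. ennreal (kappa (\<rho> n)))"
    using \<rho> by (simp add: ennreal_kappa)
  also have "\<dots> \<le> liminf (\<lambda>n. ennreal C)"
    using C \<rho> by (intro Liminf_mono always_eventually) (auto intro: ennreal_leI)
  also have "\<dots> < \<infinity>" by (simp add: Liminf_const)
  finally show ?thesis
    by (simp add: hyperbolically_integrable_def)
qed

lemma kappa_bounded_of_hyperbolically_integrable:
  assumes one: "emeasure \<nu> {1} = 0" and hyp: "hyperbolically_integrable \<nu>"
  shows "kappa_bounded 1"
proof -
  let ?I = "\<integral>\<^sup>+r\<in>{0..<1}. ennreal (1 / (1 - r\<^sup>2)) \<partial>\<nu>"
  have I: "?I < \<infinity>" using hyp by (simp add: hyperbolically_integrable_def)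
  have "AE r in \<nu>. r \<noteq> 1"
    using one by (intro AE_I[of _ _ "{1}"]) (auto intro: sets_nu_iff)
  have "kappa \<rho> \<le> enn2real (2 * ?I)" if \<rho>: "\<rho> \<in> {0..<1}" for \<rho>
  proof -
    have "ennreal (kappa \<rho>) = (\<integral>\<^sup>+r. ennreal (1 / (1 - r * \<rho>)) \<partial>\<nu>)"
      using \<rho> by (intro ennreal_kappa) auto
    also have "\<dots> \<le> (\<integral>\<^sup>+r. 2 * (ennreal (1 / (1 - r\<^sup>2)) * indicator {0..<1} r) \<partial>\<nu>)"
    proof (rule nn_integral_mono_AE)
      show "AE r in \<nu>. ennreal (1 / (1 - r * \<rho>)) \<le> 2 * (ennreal (1 / (1 - r\<^sup>2)) * indicator {0..<1} r)"
        using \<open>AE r in \<nu>. r \<noteq> 1\<close> AE_space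
      proof eventually_elim
        case (elim r)
        then have r: "0 \<le> r" "r < 1" by (auto simp: space_nu)
        have "r * \<rho> \<le> r * 1" using r \<rho> by (intro mult_left_mono) auto
        then have "1 / (1 - r * \<rho>) \<le> 1 / (1 - r)"
          using r by (intro divide_left_mono mult_pos_pos) auto
        also have "\<dots> = (1 + r) / (1 - r\<^sup>2)"
        proof -
          have "1 - r\<^sup>2 = (1 + r) * (1 - r)" by (simp add: power2_eq_square algebra_simps)
          then show ?thesis using r by simp
        qed
        also have "\<dots> \<le> 2 * (1 / (1 - r\<^sup>2))"
          using r by (simp add: divide_right_mono power_le_one)
        finally have "ennreal (1 / (1 - r * \<rho>)) \<le> ennreal (2 * (1 / (1 - r\<^sup>2)))"
          by (rule ennreal_leI)
        also have "\<dots> = 2 * ennreal (1 / (1 - r\<^sup>2))"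
          using r by (subst ennreal_mult) (auto simp: power_le_one)
        finally show ?case using r by simp
      qed
    qed
    also have "\<dots> = 2 * ?I"
      by (intro nn_integral_cmult borel_measurable_nu) measurable
    also have "\<dots> = ennreal (enn2real (2 * ?I))"
      using I by (simp add: ennreal_mult_less_top)
    finally show ?thesis by (simp add: ennreal_le_iff)
  qed
  then show ?thesis
    unfolding kappa_bounded_def by (intro exI[of _ "enn2real (2 * ?I)"]) auto
qed

text \<open>
  Some exponent \<open>c > 1\<close> has a finite weighted integral, and its weight is \<open>\<infinity>\<close> at \<open>r = 1\<close>.
\<close>
lemma emeasure_one_eq_0:
  assumes "1 < critical_index \<nu>"
  shows "emeasure \<nu> {1} = 0"
proof -
  have "\<exists>c. 1 < c \<and> (\<integral>\<^sup>+r. inv_power_weight (enn2real (2 / conj_exponent c)) r \<partial>\<nu>) < \<infinity>"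
  proof (rule ccontr)
    assume none: "\<not> ?thesis"
    have "(\<integral>\<^sup>+r. inv_power_weight (enn2real (2 / conj_exponent 1)) r \<partial>\<nu>) < \<infinity>"
      by (simp add: conj_exponent_def inv_power_weight_def emeasure_eq_measure)
    then have "critical_index \<nu> \<le> 1"
      unfolding critical_index_def using none
      by (intro cSup_least) (fastforce, blast intro: leI)
    with assms show False by simp
  qed
  then obtain c where c: "1 < c"
    and fin: "(\<integral>\<^sup>+r. inv_power_weight (enn2real (2 / conj_exponent c)) r \<partial>\<nu>) < \<infinity>" by blast
  define s where "s = enn2real (2 / conj_exponent c)"
  have "s \<noteq> 0" using c by (simp add: s_def enn2real_two_div_conj_exponent field_simps)
  then have "inv_power_weight s 1 = \<infinity>"
    by (simp add: inv_power_weight_def)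
  then have "(\<integral>\<^sup>+r. \<infinity> * indicator {1} r \<partial>\<nu>) \<le> (\<integral>\<^sup>+r. inv_power_weight s r \<partial>\<nu>)"
    by (intro nn_integral_mono) (auto simp: indicator_def)
  also have "\<dots> < \<infinity>" using fin by (simp add: s_def)
  also have "(\<integral>\<^sup>+r. \<infinity> * indicator {1} r \<partial>\<nu>) = \<infinity> * emeasure \<nu> {1}"
    by (rule nn_integral_cmult_indicator) (auto intro: sets_nu_iff)
  finally show ?thesis
    by (auto simp: ennreal_mult_less_top)
qed

lemma carleson_condition_0: "carleson_condition 0 \<nu>"
proof -
  have "(SUP t\<in>{0<..1}. emeasure \<nu> {1 - t..<1} / ennreal (t powr 0)) \<le> emeasure \<nu> (space \<nu>)"
    by (intro SUP_least) (auto simp: divide_ennreal_def intro: emeasure_space)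
  also have "\<dots> < \<infinity>"
    by (simp add: emeasure_eq_measure)
  finally show ?thesis
    by (simp add: carleson_condition_def)
qed

end

theorem theorem6p3:
  fixes \<nu> :: "real measure"
  assumes "finite_measure \<nu>"
    and "sets \<nu> = sets (restrict_space borel {0..1})"
  shows "(1 \<le> critical_index \<nu> \<and> critical_index \<nu> < 2 \<longrightarrow>
            (T_bounded_Lp_Bloch \<nu> (conj_exponent (critical_index \<nu>)) \<longleftrightarrow>
             carleson_condition (enn2real (2 / conj_exponent (critical_index \<nu>))) \<nu>)) \<and>
         (critical_index \<nu> = 2 \<longrightarrow>
            (T_bounded_Lp_Bloch \<nu> 2 \<longleftrightarrow> hyperbolically_integrable \<nu>))"
proof -
  interpret finite_measure \<nu> by fact
  interpret unit_interval_measure \<nu> by standard fact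
  let ?c = "critical_index \<nu>"
  have bounded_iff: "T_bounded_Lp_Bloch \<nu> (conj_exponent c) \<longleftrightarrow> kappa_bounded (2 - 2 / c)"
    if "1 < c" "c \<le> 2" for c
    using that kappa_bounded_of_T_bounded T_bounded_of_kappa_bounded by blast
  have a: "T_bounded_Lp_Bloch \<nu> (conj_exponent ?c) \<longleftrightarrow>
      carleson_condition (enn2real (2 / conj_exponent ?c)) \<nu>" if c: "1 \<le> ?c" "?c < 2"
  proof (cases "?c = 1")
    case True
    then show ?thesis
      using T_bounded_Linfty_Bloch carleson_condition_0 by (simp add: conj_exponent_def)
  next
    case False
    with c have c1: "1 < ?c" by simp
    have "0 < 2 - 2 / ?c" "2 - 2 / ?c < 1"
      using c1 c(2) by (auto simp: field_simps)
    then have "kappa_bounded (2 - 2 / ?c) \<longleftrightarrow> carleson_condition (2 - 2 / ?c) \<nu>"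
      using kappa_bounded_of_carleson carleson_of_kappa_bounded emeasure_one_eq_0[OF c1] by blast
    then show ?thesis
      using bounded_iff[OF c1] c(2) by (simp add: enn2real_two_div_conj_exponent[OF c1])
  qed
  have b: "T_bounded_Lp_Bloch \<nu> 2 \<longleftrightarrow> hyperbolically_integrable \<nu>" if c: "?c = 2"
  proof -
    have "T_bounded_Lp_Bloch \<nu> 2 \<longleftrightarrow> kappa_bounded 1"
      using bounded_iff[of 2] by (simp add: conj_exponent_def)
    also have "\<dots> \<longleftrightarrow> hyperbolically_integrable \<nu>"
      using hyperbolically_integrable_of_kappa_bounded kappa_bounded_of_hyperbolically_integrable
        emeasure_one_eq_0 c by auto
    finally show ?thesis .
  qed
  show ?thesis using a b by blast
qed

end
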